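(* Every 6-balanced looped simple graph $G=(V,E,L)$ is rigid as a linearly constrained framework in $\mathbb{R}^2$.
   Context: A looped simple graph $G=(V,E,L)$ consists of a finite vertex set $V$, a set $E$ of edges forming a simple graph on $V$, and a set $L$ of loops, each incident with one vertex (multiple loops at a vertex allowed). $G$ is $k$-balanced if for every $T\subseteq V$ with $|T|\le k$, every connected component of $G-T$ (delete the vertices of $T$ together with all incident edges and loops) has at least $k-|T|$ vertices incident with loops. For $p:V\to\mathbb{R}^2$, $q:L\to\mathbb{R}^2$, the rigidity matrix $R(G,p,q)$ is the $(|E|+|L|)\times 2|V|$ matrix with two columns per vertex, where the row of an edge $uv$ has $p(u)-p(v)$ in the columns of $u$, $p(v)-p(u)$ in the columns of $v$, zeros elsewhere, and the row of a loop $l$ at $v$ has $q(l)$ in the columns of $v$, zeros elsewhere. $G$ is rigid as a linearly constrained framework in $\mathbb{R}^2$ if $\operatorname{rank} R(G,p,q)=2|V|$ for some (equivalently, for generic, i.e. with coordinates algebraically independent over $\mathbb{Q}$) $(p,q)$. *)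

theory Defs
  imports "HOL-Analysis.Analysis" "Jordan_Normal_Form.DL_Rank"
begin

no_notation Matrix.vec_index (infixl "$" 100)

section \<open>Looped simple graphs\<close>

record ('v, 'l) looped_graph =
  vertices :: "'v set"
  edges :: "'v set set"
  loops :: "'l set"
  loop_vertex :: "'l \<Rightarrow> 'v"

definition looped_simple_graph :: "('v, 'l) looped_graph \<Rightarrow> bool" where
  "looped_simple_graph G \<longleftrightarrow>
     finite (vertices G) \<and>
     (\<forall>e\<in>edges G. e \<subseteq> vertices G \<and> card e = 2) \<and>
     finite (loops G) \<and>
     (\<forall>l\<in>loops G. loop_vertex G l \<in> vertices G)"

definition delete_vertices :: "('v, 'l) looped_graph \<Rightarrow> 'v set \<Rightarrow> ('v, 'l) looped_graph" where
  "delete_vertices G T = \<lparr>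
     vertices = vertices G - T,
     edges = {e \<in> edges G. e \<inter> T = {}},
     loops = {l \<in> loops G. loop_vertex G l \<notin> T},
     loop_vertex = loop_vertex G\<rparr>"

definition adjacency :: "('v, 'l) looped_graph \<Rightarrow> 'v rel" where
  "adjacency G = {(u, v). {u, v} \<in> edges G}"

text \<open>A connected component is represented by its vertex set.\<close>

definition graph_components :: "('v, 'l) looped_graph \<Rightarrow> 'v set set" where
  "graph_components G = (\<lambda>v. (adjacency G)\<^sup>* `` {v}) ` vertices G"

definition looped_vertices :: "('v, 'l) looped_graph \<Rightarrow> 'v set" where
  "looped_vertices G = loop_vertex G ` loops G"

text \<open>The subtraction below is on natural numbers; it never truncates, as the cardinality of
  \<open>T\<close> is at most \<open>k\<close>.\<close>

definition balanced :: "nat \<Rightarrow> ('v, 'l) looped_graph \<Rightarrow> bool" where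
  "balanced k G \<longleftrightarrow>
     (\<forall>T \<subseteq> vertices G. card T \<le> k \<longrightarrow>
        (\<forall>C \<in> graph_components (delete_vertices G T).
           card (C \<inter> looped_vertices (delete_vertices G T)) \<ge> k - card T))"

section \<open>Rigidity as a linearly constrained framework in the plane\<close>

text \<open>The rows and columns of a rigidity matrix are labelled by edges, loops and vertices, while
  those of a \<^typ>\<open>real mat\<close> are numbered. An arbitrary but fixed enumeration of each label
  set is used; the rank does not depend on this choice.\<close>

definition enumeration :: "'a set \<Rightarrow> 'a list" where
  "enumeration A = (SOME xs. distinct xs \<and> set xs = A)"

lemma enumeration:
  assumes "finite A"
  shows "distinct (enumeration A)" "set (enumeration A) = A" "length (enumeration A) = card A"
proof -
  have "distinct (enumeration A) \<and> set (enumeration A) = A"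
    unfolding enumeration_def
    by (rule someI_ex) (use finite_distinct_list[OF assms] in blast)
  then show "distinct (enumeration A)" "set (enumeration A) = A"
    "length (enumeration A) = card A"
    by (auto dest: distinct_card)
qed

text \<open>The blocks of the row of an edge \<open>e\<close> and of the row of a loop \<open>l\<close>
  in the two columns of a vertex \<open>w\<close>. If \<open>w\<close> is an end of \<open>e\<close>, then
  \<^term>\<open>the_elem (e - {w})\<close> is the other end.\<close>

definition edge_block :: "('v \<Rightarrow> real^2) \<Rightarrow> 'v set \<Rightarrow> 'v \<Rightarrow> real^2" where
  "edge_block p e w = (if w \<in> e then p w - p (the_elem (e - {w})) else 0)"

definition loop_block ::
  "('v, 'l) looped_graph \<Rightarrow> ('l \<Rightarrow> real^2) \<Rightarrow> 'l \<Rightarrow> 'v \<Rightarrow> real^2" where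
  "loop_block G q l w = (if w = loop_vertex G l then q l else 0)"

lemma edge_block_pair:
  assumes "u \<noteq> v"
  shows "edge_block p {u, v} u = p u - p v" "edge_block p {u, v} v = p v - p u"
    "w \<noteq> u \<Longrightarrow> w \<noteq> v \<Longrightarrow> edge_block p {u, v} w = 0"
proof -
  have "{u, v} - {u} = {v}" "{u, v} - {v} = {u}"
    using assms by auto
  then show "edge_block p {u, v} u = p u - p v" "edge_block p {u, v} v = p v - p u"
    "w \<noteq> u \<Longrightarrow> w \<noteq> v \<Longrightarrow> edge_block p {u, v} w = 0"
    by (simp_all add: edge_block_def)
qed

text \<open>The edge rows come first. Columns \<open>2 * k\<close> and \<open>2 * k + 1\<close> are the first and
  second coordinate column of the \<open>k\<close>-th vertex.\<close>

definition rigidity_matrix ::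
  "('v, 'l) looped_graph \<Rightarrow> ('v \<Rightarrow> real^2) \<Rightarrow> ('l \<Rightarrow> real^2) \<Rightarrow> real mat" where
  "rigidity_matrix G p q =
     mat (card (edges G) + card (loops G)) (2 * card (vertices G))
       (\<lambda>(i, j).
          let w = enumeration (vertices G) ! (j div 2);
              b = (if i < card (edges G)
                   then edge_block p (enumeration (edges G) ! i) w
                   else loop_block G q (enumeration (loops G) ! (i - card (edges G))) w)
          in if even j then b $ 1 else b $ 2)"

definition rigid :: "('v, 'l) looped_graph \<Rightarrow> bool" where
  "rigid G \<longleftrightarrow>
     (\<exists>p q. vec_space.rank (card (edges G) + card (loops G)) (rigidity_matrix G p q)
              = 2 * card (vertices G))"

end

theory Submission
  imports Defs
begin

text \<open>A subgraph is sparse if every vertex set \<open>X\<close> with at least two elements induces at most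
  \<open>2|X| - 3\<close> edges and every \<open>X\<close> induces at most \<open>2|X|\<close> edges and loops. In a maximal sparse
  subgraph of a balanced graph every edge lies in a tight set. Let \<open>Z\<close> be the largest set that
  is tight for edges and loops together; the maximal edge-tight sets outside \<open>Z\<close> (blocks) meet
  \<open>Z\<close> and each other in at most one vertex. As in the Lovasz-Yemini theorem, a discharging
  argument over the blocks, using that a block with a private unlooped vertex has at least six
  non-private ones, shows that the subgraph has \<open>2|V|\<close> edges and loops.

  Such a sparse subgraph is infinitesimally rigid in a suitable position by Henneberg induction:
  some vertex has degree two or three, its removal (with an edge added or a loop moved
  elsewhere in the second case) leaves a smaller graph of the same kind, and the vertex is put
  back in a special position of a realisation of the smaller graph. As the rigidity matrix is
  square, rigidity survives small perturbations, which supplies the general position needed.\<close>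

section \<open>Sparse graphs and tight sets\<close>

definition edge_count :: "('v, 'l) looped_graph \<Rightarrow> 'v set \<Rightarrow> nat" where
  "edge_count G X = card {e \<in> edges G. e \<subseteq> X}"

definition loop_count :: "('v, 'l) looped_graph \<Rightarrow> 'v set \<Rightarrow> nat" where
  "loop_count G X = card {l \<in> loops G. loop_vertex G l \<in> X}"

text \<open>The first count reflects the three trivial motions of a plane framework on two or more
  points, the second the \<open>2 * card X\<close> columns available to rows inside
  \<open>X\<close>. Adding 3 on the left avoids truncated subtraction.\<close>

definition sparse_graph :: "('v, 'l) looped_graph \<Rightarrow> bool" where
  "sparse_graph G \<longleftrightarrow> looped_simple_graph G \<and>
     (\<forall>X \<subseteq> vertices G. 2 \<le> card X \<longrightarrow> edge_count G X + 3 \<le> 2 * card X) \<and>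
     (\<forall>X \<subseteq> vertices G. edge_count G X + loop_count G X \<le> 2 * card X)"

definition edge_tight :: "('v, 'l) looped_graph \<Rightarrow> 'v set \<Rightarrow> bool" where
  "edge_tight G X \<longleftrightarrow> X \<subseteq> vertices G \<and> 2 \<le> card X \<and> edge_count G X + 3 = 2 * card X"

definition loop_tight :: "('v, 'l) looped_graph \<Rightarrow> 'v set \<Rightarrow> bool" where
  "loop_tight G X \<longleftrightarrow> X \<subseteq> vertices G \<and> edge_count G X + loop_count G X = 2 * card X"

lemma looped_simple_graphD:
  assumes "looped_simple_graph G"
  shows "finite (vertices G)" "finite (edges G)" "finite (loops G)"
    "e \<in> edges G \<Longrightarrow> e \<subseteq> vertices G" "e \<in> edges G \<Longrightarrow> card e = 2"
    "l \<in> loops G \<Longrightarrow> loop_vertex G l \<in> vertices G"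
proof -
  have "edges G \<subseteq> Pow (vertices G)" "finite (vertices G)"
    using assms by (auto simp: looped_simple_graph_def)
  then show "finite (edges G)"
    by (meson finite_Pow_iff finite_subset)
qed (use assms in \<open>auto simp: looped_simple_graph_def\<close>)

lemma sparse_graphD:
  assumes "sparse_graph G"
  shows "looped_simple_graph G"
    "X \<subseteq> vertices G \<Longrightarrow> 2 \<le> card X \<Longrightarrow> edge_count G X + 3 \<le> 2 * card X"
    "X \<subseteq> vertices G \<Longrightarrow> edge_count G X + loop_count G X \<le> 2 * card X"
  using assms by (auto simp: sparse_graph_def)

section \<open>Uncrossing of tight sets\<close>

text \<open>Edges inside both sets are counted again by the intersection. The slack comes from edges
  of the union lying in neither set, such as those joining \<open>X - Y\<close> to
  \<open>Y - X\<close>.\<close>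

lemma edge_count_supermodular:
  assumes "finite (edges G)"
  shows "edge_count G X + edge_count G Y \<le> edge_count G (X \<union> Y) + edge_count G (X \<inter> Y)"
proof -
  let ?E = "\<lambda>X. {e \<in> edges G. e \<subseteq> X}"
  have "card (?E X) + card (?E Y) = card (?E X \<union> ?E Y) + card (?E X \<inter> ?E Y)"
    using assms by (intro card_Un_Int) auto
  moreover have "card (?E X \<union> ?E Y) \<le> card (?E (X \<union> Y))"
    using assms by (intro card_mono) auto
  moreover have "?E X \<inter> ?E Y = ?E (X \<inter> Y)"
    by auto
  ultimately show ?thesis
    by (simp add: edge_count_def)
qed

text \<open>Equality holds because a loop has a single end and cannot cross between the
  sets.\<close>

lemma loop_count_modular:
  assumes "finite (loops G)"
  shows "loop_count G X + loop_count G Y = loop_count G (X \<union> Y) + loop_count G (X \<inter> Y)"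
proof -
  let ?L = "\<lambda>X. {l \<in> loops G. loop_vertex G l \<in> X}"
  have "card (?L X) + card (?L Y) = card (?L X \<union> ?L Y) + card (?L X \<inter> ?L Y)"
    using assms by (intro card_Un_Int) auto
  moreover have "?L X \<union> ?L Y = ?L (X \<union> Y)" "?L X \<inter> ?L Y = ?L (X \<inter> Y)"
    by auto
  ultimately show ?thesis
    by (simp add: loop_count_def)
qed

lemma loop_count_mono:
  assumes "finite (loops G)" "X \<subseteq> Y"
  shows "loop_count G X \<le> loop_count G Y"
  unfolding loop_count_def using assms by (intro card_mono) auto

text \<open>Supermodularity forces equality in the sparsity bounds of union and intersection. The
  overlap condition makes the bound with 3 applicable to the intersection.\<close>

lemma edge_tight_Un:
  assumes "sparse_graph G" "edge_tight G X" "edge_tight G Y" "2 \<le> card (X \<inter> Y)"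
  shows "edge_tight G (X \<union> Y)"
proof -
  note G = looped_simple_graphD[OF sparse_graphD(1)[OF assms(1)]]
  have XY: "X \<subseteq> vertices G" "Y \<subseteq> vertices G" "2 \<le> card X"
    "edge_count G X + 3 = 2 * card X" "edge_count G Y + 3 = 2 * card Y"
    using assms by (auto simp: edge_tight_def)
  then have fin: "finite X" "finite Y"
    using G(1) finite_subset by auto
  have "card X + card Y = card (X \<union> Y) + card (X \<inter> Y)"
    using card_Un_Int[OF fin] .
  moreover have "card X \<le> card (X \<union> Y)"
    using fin by (intro card_mono) auto
  moreover have "edge_count G (X \<union> Y) + 3 \<le> 2 * card (X \<union> Y)"
    using XY calculation(2) by (intro sparse_graphD(2)[OF assms(1)]) auto
  moreover have "edge_count G (X \<inter> Y) + 3 \<le> 2 * card (X \<inter> Y)"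
    using XY assms(4) by (intro sparse_graphD(2)[OF assms(1)]) auto
  ultimately show ?thesis
    using edge_count_supermodular[OF G(2), of X Y] XY by (auto simp: edge_tight_def)
qed

text \<open>The same uncrossing as for edges alone; the total count bounds every intersection, even
  an empty one.\<close>

lemma loop_tight_Un:
  assumes "sparse_graph G" "loop_tight G X" "loop_tight G Y"
  shows "loop_tight G (X \<union> Y)"
proof -
  note G = looped_simple_graphD[OF sparse_graphD(1)[OF assms(1)]]
  have XY: "X \<subseteq> vertices G" "Y \<subseteq> vertices G"
    "edge_count G X + loop_count G X = 2 * card X" "edge_count G Y + loop_count G Y = 2 * card Y"
    using assms by (auto simp: loop_tight_def)
  then have fin: "finite X" "finite Y"
    using G(1) finite_subset by auto
  have "card X + card Y = card (X \<union> Y) + card (X \<inter> Y)"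
    using card_Un_Int[OF fin] .
  moreover have "edge_count G (X \<union> Y) + loop_count G (X \<union> Y) \<le> 2 * card (X \<union> Y)"
    "edge_count G (X \<inter> Y) + loop_count G (X \<inter> Y) \<le> 2 * card (X \<inter> Y)"
    using XY by (auto intro!: sparse_graphD(3)[OF assms(1)])
  ultimately show ?thesis
    using edge_count_supermodular[OF G(2), of X Y] loop_count_modular[OF G(3), of X Y] XY
    by (auto simp: loop_tight_def)
qed

text \<open>The deficit 3 of \<open>Y\<close> cancels against the deficit 3 in the edge bound of the
  intersection, and further loops in \<open>Y\<close> can only raise the count of the union.\<close>

lemma loop_tight_Un_edge_tight:
  assumes "sparse_graph G" "loop_tight G X" "edge_tight G Y" "2 \<le> card (X \<inter> Y)"
  shows "loop_tight G (X \<union> Y)"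
proof -
  note G = looped_simple_graphD[OF sparse_graphD(1)[OF assms(1)]]
  have XY: "X \<subseteq> vertices G" "Y \<subseteq> vertices G"
    "edge_count G X + loop_count G X = 2 * card X" "edge_count G Y + 3 = 2 * card Y"
    using assms by (auto simp: loop_tight_def edge_tight_def)
  then have fin: "finite X" "finite Y"
    using G(1) finite_subset by auto
  have "card X + card Y = card (X \<union> Y) + card (X \<inter> Y)"
    using card_Un_Int[OF fin] .
  moreover have "edge_count G (X \<union> Y) + loop_count G (X \<union> Y) \<le> 2 * card (X \<union> Y)"
    using XY by (auto intro!: sparse_graphD(3)[OF assms(1)])
  moreover have "edge_count G (X \<inter> Y) + 3 \<le> 2 * card (X \<inter> Y)"
    using XY assms(4) by (intro sparse_graphD(2)[OF assms(1)]) auto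
  moreover have "loop_count G X \<le> loop_count G (X \<union> Y)"
    by (rule loop_count_mono[OF G(3)]) auto
  ultimately show ?thesis
    using edge_count_supermodular[OF G(2), of X Y] XY
    by (auto simp: loop_tight_def)
qed

lemma loop_tight_Union:
  assumes "sparse_graph G" "finite A" "\<And>X. X \<in> A \<Longrightarrow> loop_tight G X"
  shows "loop_tight G (\<Union>A)"
  using assms(2,3)
proof (induction A)
  case empty
  \<comment> \<open>The empty union is tight because no edge is empty.\<close>
  have "e \<noteq> {}" if "e \<in> edges G" for e
    using looped_simple_graphD(5)[OF sparse_graphD(1)[OF assms(1)] that] by auto
  then show ?case
    by (auto simp: loop_tight_def edge_count_def loop_count_def)
next
  case (insert X A)
  then show ?case
    using loop_tight_Un[OF assms(1)] by auto
qed

text \<open>An edge has two ends while distinct sets share at most one vertex, so no edge is counted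
  twice.\<close>

lemma sum_edge_count_le:
  assumes "looped_simple_graph G" "finite B"
    and "\<And>X. X \<in> B \<Longrightarrow> X \<subseteq> vertices G"
    and small: "\<And>X Y. X \<in> B \<Longrightarrow> Y \<in> B \<Longrightarrow> X \<noteq> Y \<Longrightarrow> card (X \<inter> Y) \<le> 1"
  shows "(\<Sum>X\<in>B. edge_count G X) \<le> edge_count G (\<Union>B)"
proof -
  note G = looped_simple_graphD[OF assms(1)]
  let ?E = "\<lambda>X. {e \<in> edges G. e \<subseteq> X}"
  have disj: "?E X \<inter> ?E Y = {}" if "X \<in> B" "Y \<in> B" "X \<noteq> Y" for X Y
  proof (rule ccontr)
    assume "?E X \<inter> ?E Y \<noteq> {}"
    then obtain e where e: "e \<in> edges G" "e \<subseteq> X \<inter> Y" by auto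
    have "finite (X \<inter> Y)"
      using assms(3)[OF that(1)] G(1) finite_subset by auto
    then have "card e \<le> card (X \<inter> Y)"
      using e(2) by (rule card_mono)
    then show False
      using small[OF that] G(5)[OF e(1)] by simp
  qed
  have "(\<Sum>X\<in>B. card (?E X)) = card (\<Union>X\<in>B. ?E X)"
    using assms(2) G(2) disj by (intro card_UN_disjoint[symmetric]) auto
  also have "\<dots> \<le> card (?E (\<Union>B))"
    using G(2) by (intro card_mono) auto
  finally show ?thesis
    by (simp add: edge_count_def)
qed

section \<open>Obstructions to adding an edge or a loop\<close>

text \<open>A new edge raises by one exactly the counts of the sets containing both its ends, so
  only a tight set among these can block it.\<close>

lemma insert_edge_sparse_or_tight:
  assumes "sparse_graph H" "e \<subseteq> vertices H" "card e = 2"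
  shows "(e \<notin> edges H \<and> sparse_graph (H\<lparr>edges := insert e (edges H)\<rparr>)) \<or>
    (\<exists>X. e \<subseteq> X \<and> (edge_tight H X \<or> loop_tight H X))"
proof (cases "e \<in> edges H")
  case True
  \<comment> \<open>An edge that is already present is itself an edge-tight set, as 1 + 3 = 2 *
    2.\<close>
  have "{f \<in> edges H. f \<subseteq> e} = {e}"
  proof -
    have "f = e" if "f \<in> edges H" "f \<subseteq> e" for f
      using looped_simple_graphD(5)[OF sparse_graphD(1)[OF assms(1)] that(1)] assms(3) that(2)
      by (metis card.infinite card_subset_eq zero_neq_numeral)
    then show ?thesis
      using True by auto
  qed
  then have "edge_tight H e"
    using assms by (simp add: edge_tight_def edge_count_def)
  then show ?thesis
    by blast
next
  case False
  let ?H = "H\<lparr>edges := insert e (edges H)\<rparr>"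
  note H = looped_simple_graphD[OF sparse_graphD(1)[OF assms(1)]]
  have ec: "edge_count ?H X = edge_count H X + (if e \<subseteq> X then 1 else 0)" for X
  proof -
    have "{f \<in> edges ?H. f \<subseteq> X} =
        (if e \<subseteq> X then insert e {f \<in> edges H. f \<subseteq> X} else {f \<in> edges H. f \<subseteq> X})"
      by auto
    then show ?thesis
      using False H(2) by (simp add: edge_count_def)
  qed
  have lc: "loop_count ?H X = loop_count H X" for X
    by (simp add: loop_count_def)
  have simple: "looped_simple_graph ?H"
    using sparse_graphD(1)[OF assms(1)] assms(2,3) by (simp add: looped_simple_graph_def)
  show ?thesis
  proof (cases "\<exists>X. e \<subseteq> X \<and> (edge_tight H X \<or> loop_tight H X)")
    case not_tight: False
    have edge_sparse: "edge_count ?H X + 3 \<le> 2 * card X" if "X \<subseteq> vertices H" "2 \<le> card X" for X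
    proof -
      have "\<not> (e \<subseteq> X \<and> edge_tight H X)"
        using not_tight by blast
      then show ?thesis
        using sparse_graphD(2)[OF assms(1) that] that by (auto simp: ec edge_tight_def)
    qed
    have loop_sparse: "edge_count ?H X + loop_count ?H X \<le> 2 * card X" if "X \<subseteq> vertices H" for X
    proof -
      have "\<not> (e \<subseteq> X \<and> loop_tight H X)"
        using not_tight by blast
      then show ?thesis
        using sparse_graphD(3)[OF assms(1) that] that by (auto simp: ec lc loop_tight_def)
    qed
    have "sparse_graph ?H"
      unfolding sparse_graph_def
      by (intro conjI allI impI simple edge_sparse loop_sparse) simp_all
    then show ?thesis
      using False by blast
  qed blast
qed

text \<open>A loop at \<open>v\<close> affects only the total count of sets containing
  \<open>v\<close>. Overwriting \<open>loop_vertex\<close> at \<open>l\<close> allows the label of a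
  removed loop to be reused at another vertex.\<close>

lemma insert_loop_sparse_or_tight:
  assumes "sparse_graph H" "v \<in> vertices H" "l \<notin> loops H"
  shows "sparse_graph (H\<lparr>loops := insert l (loops H), loop_vertex := (loop_vertex H)(l := v)\<rparr>) \<or>
    (\<exists>X. v \<in> X \<and> loop_tight H X)"
proof -
  let ?H = "H\<lparr>loops := insert l (loops H), loop_vertex := (loop_vertex H)(l := v)\<rparr>"
  note H = looped_simple_graphD[OF sparse_graphD(1)[OF assms(1)]]
  have ec: "edge_count ?H X = edge_count H X" for X
    by (simp add: edge_count_def)
  have lc: "loop_count ?H X = loop_count H X + (if v \<in> X then 1 else 0)" for X
  proof -
    have "{k \<in> loops ?H. loop_vertex ?H k \<in> X} =
        (if v \<in> X then insert l {k \<in> loops H. loop_vertex H k \<in> X}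
         else {k \<in> loops H. loop_vertex H k \<in> X})"
      using assms(3) by auto
    then show ?thesis
      using assms(3) H(3) by (simp add: loop_count_def)
  qed
  have simple: "looped_simple_graph ?H"
    using sparse_graphD(1)[OF assms(1)] assms(2) by (simp add: looped_simple_graph_def)
  show ?thesis
  proof (cases "\<exists>X. v \<in> X \<and> loop_tight H X")
    case False
    have edge_sparse: "edge_count ?H X + 3 \<le> 2 * card X" if "X \<subseteq> vertices H" "2 \<le> card X" for X
      using sparse_graphD(2)[OF assms(1) that] by (simp add: ec)
    have loop_sparse: "edge_count ?H X + loop_count ?H X \<le> 2 * card X" if "X \<subseteq> vertices H" for X
    proof -
      have "\<not> (v \<in> X \<and> loop_tight H X)"
        using False by blast
      then show ?thesis
        using sparse_graphD(3)[OF assms(1) that] that by (auto simp: ec lc loop_tight_def)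
    qed
    have "sparse_graph ?H"
      unfolding sparse_graph_def
      by (intro conjI allI impI simple edge_sparse loop_sparse) simp_all
    then show ?thesis ..
  qed blast
qed

section \<open>Balanced graphs contain tight spanning subgraphs\<close>

text \<open>A set \<open>S\<close> whose outgoing edges all end in \<open>T\<close> contains a whole
  component of the graph without \<open>T\<close>. This is applied to a vertex with its neighbours
  and to the interior of a block with the rest of the block.\<close>

lemma balanced_separation:
  assumes "looped_simple_graph G" "balanced k G" "T \<subseteq> vertices G"
    and "v \<in> S" "S \<subseteq> vertices G - T"
    and closed: "\<And>a b. a \<in> S \<Longrightarrow> {a, b} \<in> edges G \<Longrightarrow> b \<in> S \<union> T"
  shows "k \<le> card T + card (S \<inter> looped_vertices G)"
proof (cases "card T \<le> k")
  case True
  let ?D = "delete_vertices G T"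
  let ?C = "(adjacency ?D)\<^sup>* `` {v}"
  have "w \<in> S" if "(v, w) \<in> (adjacency ?D)\<^sup>*" for w
    using that
  proof induction
    case (step a b)
    then have "{a, b} \<in> edges G" "b \<notin> T"
      by (auto simp: adjacency_def delete_vertices_def)
    then show ?case
      using closed step by blast
  qed (use assms in auto)
  then have "?C \<subseteq> S"
    by blast
  then have sub: "?C \<inter> looped_vertices ?D \<subseteq> S \<inter> looped_vertices G"
    by (auto simp: looped_vertices_def delete_vertices_def)
  have "?C \<in> graph_components ?D"
    using assms(4,5) by (auto simp: graph_components_def delete_vertices_def)
  then have "k - card T \<le> card (?C \<inter> looped_vertices ?D)"
    using assms(2,3) True by (auto simp: balanced_def)
  also have "\<dots> \<le> card (S \<inter> looped_vertices G)"
    using sub assms(1,5) by (intro card_mono) (auto simp: looped_simple_graph_def finite_subset)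
  finally show ?thesis
    by simp
qed auto

section \<open>Discharging over the blocks\<close>

text \<open>Double counting of the incidences between vertices and sets, each weighted by its
  set.\<close>

lemma sum_incidences_swap:
  fixes m :: "'a set \<Rightarrow> nat"
  assumes "finite A" "finite B"
  shows "(\<Sum>X\<in>B. card (X \<inter> A) * m X) = (\<Sum>v\<in>A. \<Sum>X\<in>{X\<in>B. v \<in> X}. m X)"
proof -
  have "(\<Sum>X\<in>B. card (X \<inter> A) * m X) = (\<Sum>X\<in>B. \<Sum>v\<in>{v\<in>A. v \<in> X}. m X)"
    by (simp add: Collect_conj_eq Int_commute)
  also have "\<dots> = (\<Sum>v\<in>A. \<Sum>X\<in>{X\<in>B. v \<in> X}. m X)"
    using sum.swap_restrict[OF assms(2,1), of "\<lambda>X v. m X" "\<lambda>X v. v \<in> X"] by simp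
  finally show ?thesis .
qed

text \<open>To be read at a vertex lying in the blocks \<open>B\<close> of sizes \<open>c\<close>. A
  block of size at least 6 pays 6, and the loop or a second block pays the missing 2. If all blocks
  are smaller, the payments are the sum of \<open>c X - 1\<close> plus the number of blocks, that is
  at least 6 + 2 without a loop and 5 + 4 with one.\<close>

lemma incident_blocks_weight:
  fixes c :: "'a \<Rightarrow> nat"
  assumes "finite B" "\<And>X. X \<in> B \<Longrightarrow> 2 \<le> c X"
    and "6 \<le> (\<Sum>X\<in>B. c X - 1) + (if looped then 1 else 0)"
    and "looped \<or> card B \<noteq> 1"
  shows "8 \<le> (\<Sum>X\<in>B. min 6 (c X)) + (if looped then 4 else 0)"
proof (cases "\<exists>X\<in>B. 6 \<le> c X")
  case True
  then obtain X where X: "X \<in> B" "6 \<le> c X" by blast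
  have *: "(\<Sum>X\<in>B. min 6 (c X)) = 6 + (\<Sum>X\<in>B - {X}. min 6 (c X))"
    using X assms(1) by (subst sum.remove[of _ X]) auto
  show ?thesis
  proof (cases looped)
    case False
    then have "B - {X} \<noteq> {}"
      using assms(4) X by (metis Diff_eq_empty_iff card_1_singleton_iff One_nat_def subset_singletonD empty_iff)
    then obtain Y where Y: "Y \<in> B - {X}" by blast
    have "2 \<le> min 6 (c Y)"
      using assms(2) Y by auto
    also have "\<dots> \<le> (\<Sum>X\<in>B - {X}. min 6 (c X))"
      using assms(1) Y by (intro member_le_sum) auto
    finally show ?thesis
      using * by simp
  qed (use * in simp)
next
  case False
  have "(\<Sum>X\<in>B. min 6 (c X)) = (\<Sum>X\<in>B. (c X - 1) + 1)"
    using False assms(2) by (intro sum.cong) (force simp: min_def)+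
  also have "\<dots> = (\<Sum>X\<in>B. c X - 1) + card B"
    by (subst sum.distrib) simp
  finally have *: "(\<Sum>X\<in>B. min 6 (c X)) = (\<Sum>X\<in>B. c X - 1) + card B" .
  have "card B \<noteq> 0" if "\<not> looped"
    using assms(1,3) that by auto
  then show ?thesis
    using * assms(3,4) by (auto split: if_splits)
qed

text \<open>A block with \<open>t\<close> non-interior vertices can pay \<open>min 6 t / 4\<close> to each of them
  out of its count \<open>2 * t - 3\<close>.\<close>

lemma charge_bound:
  fixes t :: nat
  assumes "2 \<le> t"
  shows "t * min 6 t + 12 \<le> 8 * t"
\<comment> \<open>Below 6 the claim is (t - 2) * (t - 6) \<le> 0; from 6 on it is 12 \<le> 2 *
  t.\<close>
proof (cases "t < 6")
  case True
  then have "t = 2 \<or> t = 3 \<or> t = 4 \<or> t = 5"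
    using assms by auto
  then show ?thesis by auto
qed auto

text \<open>In quarter units, every vertex outside \<open>Z\<close> demands 8, every block offers
  four times its edge count, and every looped vertex outside \<open>Z\<close> offers 4. Meeting all
  demands bounds the total count from below, sparsity bounds it from above. The two cover hypotheses
  are what maximality of \<open>H\<close> provides.\<close>

lemma balanced_imp_loop_tight:
  assumes G: "looped_simple_graph G" "balanced 6 G"
    and H: "sparse_graph H" "vertices H = vertices G" "loop_vertex H = loop_vertex G"
    and edge_cover: "\<And>e. e \<in> edges G \<Longrightarrow> \<exists>X. e \<subseteq> X \<and> (edge_tight H X \<or> loop_tight H X)"
    and loop_cover:
      "\<And>l. l \<in> loops G \<Longrightarrow> l \<notin> loops H \<Longrightarrow> \<exists>X. loop_vertex G l \<in> X \<and> loop_tight H X"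
  shows "loop_tight H (vertices G)"
proof -
  note G' = looped_simple_graphD[OF G(1)]
  note H' = looped_simple_graphD[OF sparse_graphD(1)[OF H(1)]]
  define V where "V = vertices G"
  have fin_V: "finite V" and HV: "vertices H = V"
    using G' H(2) by (auto simp: V_def)
  define Z where "Z = \<Union>{X. loop_tight H X}"
  have "finite {X. loop_tight H X}"
    by (rule finite_subset[of _ "Pow V"]) (auto simp: loop_tight_def HV fin_V)
  then have Z: "loop_tight H Z"
    unfolding Z_def by (rule loop_tight_Union[OF H(1)]) auto
  have Z_max: "X \<subseteq> Z" if "loop_tight H X" for X
    using that by (auto simp: Z_def)
  have ZV: "Z \<subseteq> V"
    using Z by (simp add: loop_tight_def HV)
  define B where "B = {X. edge_tight H X \<and> \<not> X \<subseteq> Z \<and> (\<forall>Y. edge_tight H Y \<longrightarrow> X \<subseteq> Y \<longrightarrow> X = Y)}"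
  have BV: "X \<subseteq> V" "2 \<le> card X" "edge_count H X + 3 = 2 * card X" if "X \<in> B" for X
    using that by (auto simp: B_def edge_tight_def HV)
  have fin_B: "finite B"
    by (rule finite_subset[of _ "Pow V"]) (auto simp: BV(1)[THEN subsetD] fin_V)
  have fin_X: "finite X" if "X \<in> B" for X
    using BV(1)[OF that] fin_V finite_subset by blast
  have cover: "e \<subseteq> Z \<or> (\<exists>X\<in>B. e \<subseteq> X)" if "e \<in> edges G" for e
  proof -
    obtain X where X: "e \<subseteq> X" "edge_tight H X \<or> loop_tight H X"
      using edge_cover[OF \<open>e \<in> edges G\<close>] by blast
    show ?thesis
    proof (cases "X \<subseteq> Z")
      case False
      then have "edge_tight H X"
        using X Z_max by blast
      moreover have "finite {Y. edge_tight H Y}"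
        by (rule finite_subset[of _ "Pow V"]) (auto simp: edge_tight_def HV fin_V)
      ultimately obtain Y where "edge_tight H Y" "X \<subseteq> Y"
          "\<And>Y'. edge_tight H Y' \<Longrightarrow> Y \<subseteq> Y' \<Longrightarrow> Y = Y'"
        using finite_has_maximal2[of "{Y. edge_tight H Y}" X] by auto
      then show ?thesis
        using X False by (intro disjI2 bexI[of _ Y]) (auto simp: B_def)
    qed (use X in blast)
  qed
  \<comment> \<open>A larger overlap would make the union with \<open>Z\<close> tight, against the
    choice of \<open>Z\<close>; for two blocks it would contradict their maximality.\<close>
  have cap_Z: "card (Z \<inter> X) \<le> 1" if "X \<in> B" for X
  proof (rule ccontr)
    assume "\<not> card (Z \<inter> X) \<le> 1"
    then have "loop_tight H (Z \<union> X)"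
      using that by (intro loop_tight_Un_edge_tight[OF H(1) Z]) (auto simp: B_def)
    then show False
      using Z_max[of "Z \<union> X"] that by (auto simp: B_def)
  qed
  have cap_B: "card (X \<inter> Y) \<le> 1" if "X \<in> B" "Y \<in> B" "X \<noteq> Y" for X Y
  proof (rule ccontr)
    assume "\<not> card (X \<inter> Y) \<le> 1"
    then have "edge_tight H (X \<union> Y)"
      using that by (intro edge_tight_Un[OF H(1)]) (auto simp: B_def)
    then have "X = X \<union> Y" "Y = X \<union> Y"
      using that by (auto simp: B_def)
    then show False
      using that by simp
  qed
  define U where "U = V - Z"
  define UL where "UL = U \<inter> looped_vertices G"
  \<comment> \<open>Interior vertices: unlooped and private to one block, which alone has to meet
    their demand. \<open>W\<close> collects the other vertices outside \<open>Z\<close>.\<close>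
  define I where "I = {v\<in>U. v \<notin> looped_vertices G \<and> card {X\<in>B. v \<in> X} = 1}"
  define W where "W = U - I"
  have fin: "finite U" "finite I" "finite W" "finite UL"
    using fin_V by (auto simp: U_def I_def W_def UL_def)

  \<comment> \<open>\<open>Z\<close> and the blocks pairwise share at most one vertex, so their edge
    counts add up. \<open>Z\<close> is not itself a block, as blocks are not inside
    \<open>Z\<close>.\<close>
  have "sum (edge_count H) (insert Z B) \<le> edge_count H (\<Union>(insert Z B))"
  proof (rule sum_edge_count_le[OF sparse_graphD(1)[OF H(1)]])
    show "card (X \<inter> Y) \<le> 1" if "X \<in> insert Z B" "Y \<in> insert Z B" "X \<noteq> Y" for X Y
      using that cap_Z cap_B by (auto simp: Int_commute)
  qed (use fin_B BV(1) ZV HV in auto)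
  also have "\<dots> \<le> edge_count H V"
    unfolding edge_count_def using H' BV(1) ZV HV by (intro card_mono) auto
  finally have edges_V: "edge_count H Z + sum (edge_count H) B \<le> edge_count H V"
    using fin_B by (subst (asm) sum.insert) (auto simp: B_def)

  have "loop_count H Z + loop_count H U = loop_count H V + loop_count H {}"
    using loop_count_modular[OF H'(3), of Z U] ZV by (simp add: U_def Un_absorb1)
  \<comment> \<open>A loop missing from \<open>H\<close> has its vertex in a loop-tight set and thus
    in \<open>Z\<close>; hence vertices outside \<open>Z\<close> keep all their loops.\<close>
  moreover have "card UL \<le> loop_count H U"
  proof -
    have "UL \<subseteq> loop_vertex H ` {l \<in> loops H. loop_vertex H l \<in> U}"
    proof
      fix v assume "v \<in> UL"
      then obtain l where l: "l \<in> loops G" "loop_vertex G l = v" "v \<in> U"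
        by (auto simp: UL_def looped_vertices_def)
      have "l \<in> loops H"
        using loop_cover[OF l(1)] l(2,3) Z_max by (auto simp: U_def)
      then show "v \<in> loop_vertex H ` {l \<in> loops H. loop_vertex H l \<in> U}"
        using l H(3) by auto
    qed
    then have "card UL \<le> card (loop_vertex H ` {l \<in> loops H. loop_vertex H l \<in> U})"
      using H'(3) by (intro card_mono) auto
    also have "\<dots> \<le> loop_count H U"
      unfolding loop_count_def using H'(3) by (intro card_image_le) auto
    finally show ?thesis .
  qed
  ultimately have loops_V: "loop_count H Z + card UL \<le> loop_count H V"
    by (simp add: loop_count_def)

  \<comment> \<open>Separating \<open>v\<close> by its neighbours shows that it has at least 6 of
    them, or 5 if it is looped. As \<open>v\<close> is outside \<open>Z\<close>, each edge at
    \<open>v\<close> lies in a block, and a block \<open>X\<close> at \<open>v\<close> accounts for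
    at most \<open>card X - 1\<close> neighbours.\<close>
  have degree: "6 \<le> (\<Sum>X\<in>{X\<in>B. v \<in> X}. card X - 1) + (if v \<in> looped_vertices G then 1 else 0)"
    if "v \<in> U" for v
  proof -
    let ?N = "{w. {v, w} \<in> edges G}"
    have loopfree: "w \<noteq> v" if "{v, w} \<in> edges G" for w
      using G'(5)[OF that] by auto
    have separated: "6 \<le> card ?N + card ({v} \<inter> looped_vertices G)"
      by (rule balanced_separation[OF G, of _ v])
        (use that loopfree loopfree[of v] G'(4) in \<open>auto simp: U_def V_def\<close>)
    have "?N \<subseteq> (\<Union>X\<in>{X\<in>B. v \<in> X}. X - {v})"
    proof
      fix w assume w: "w \<in> ?N"
      then have "{v, w} \<in> edges G" by simp
      then have "{v, w} \<subseteq> Z \<or> (\<exists>X\<in>B. {v, w} \<subseteq> X)"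
        by (rule cover)
      moreover have "v \<notin> Z"
        using that by (simp add: U_def)
      ultimately obtain X where "X \<in> B" "{v, w} \<subseteq> X"
        by auto
      then show "w \<in> (\<Union>X\<in>{X\<in>B. v \<in> X}. X - {v})"
        using loopfree w by auto
    qed
    then have "card ?N \<le> card (\<Union>X\<in>{X\<in>B. v \<in> X}. X - {v})"
      using fin_B fin_X by (intro card_mono) auto
    also have "\<dots> \<le> (\<Sum>X\<in>{X\<in>B. v \<in> X}. card (X - {v}))"
      using fin_B by (intro card_UN_le) auto
    also have "\<dots> = (\<Sum>X\<in>{X\<in>B. v \<in> X}. card X - 1)"
      using fin_X by (intro sum.cong) auto
    finally show ?thesis
      using separated by (auto split: if_splits)
  qed

  text \<open>Deleting its at most five other vertices would separate the interior vertices of a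
    block, which are unlooped, from the rest of the graph.\<close>
  have interior: "X \<inter> I = {} \<or> 6 \<le> card (X - I)" if X: "X \<in> B" for X
  proof (rule disjCI)
    assume "\<not> 6 \<le> card (X - I)"
    show "X \<inter> I = {}"
    proof (rule ccontr)
      assume "X \<inter> I \<noteq> {}"
      then obtain v where v: "v \<in> X \<inter> I" by blast
      have "6 \<le> card (X - I) + card (X \<inter> I \<inter> looped_vertices G)"
      proof (rule balanced_separation[OF G _ v])
        \<comment> \<open>An edge at an interior vertex lies in some block, and \<open>X\<close> is
          the only block at that vertex.\<close>
        fix a b assume a: "a \<in> X \<inter> I" and ab: "{a, b} \<in> edges G"
        obtain Y where Y: "Y \<in> B" "{a, b} \<subseteq> Y"
          using cover[OF ab] a by (auto simp: I_def U_def)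
        obtain X' where "{X\<in>B. a \<in> X} = {X'}"
          using a by (auto simp: I_def card_1_singleton_iff)
        then have "Y = X"
          using Y X a by (metis (mono_tags, lifting) Int_iff insert_subset mem_Collect_eq singletonD)
        then show "b \<in> X \<inter> I \<union> (X - I)"
          using Y by auto
      qed (use BV(1)[OF X] in \<open>auto simp: V_def\<close>)
      moreover have "X \<inter> I \<inter> looped_vertices G = {}"
        by (auto simp: I_def)
      ultimately show False
        using \<open>\<not> 6 \<le> card (X - I)\<close> by simp
    qed
  qed

  \<comment> \<open>Four times the edge count is \<open>8 * card X - 12\<close>. Interior vertices
    take 8 each, and \<open>charge_bound\<close> covers the rest. If there are interior vertices,
    then \<open>?t\<close> is at least 6 and both minima are 6; otherwise
    \<open>?t = card X\<close>.\<close>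
  have block: "8 * card (X \<inter> I) + card (X \<inter> W) * min 6 (card X) \<le> 4 * edge_count H X"
    if X: "X \<in> B" for X
  proof -
    let ?t = "card (X - I)"
    have t: "card X = card (X \<inter> I) + ?t"
      using card_Diff_subset_Int[of X I] fin_X[OF X] card_mono[of X "X \<inter> I"] by simp
    have "2 \<le> ?t" "min 6 (card X) \<le> min 6 ?t"
      using interior[OF X] BV(2)[OF X] t by auto
    moreover have "card (X \<inter> W) \<le> ?t"
      using fin_X[OF X] by (intro card_mono) (auto simp: W_def)
    ultimately have "card (X \<inter> W) * min 6 (card X) + 12 \<le> 8 * ?t"
      using charge_bound[of ?t] mult_mono[of "card (X \<inter> W)" ?t "min 6 (card X)" "min 6 ?t"]
      by linarith
    then show ?thesis
      using t BV(3)[OF X] by linarith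
  qed

  have "8 * card I + (\<Sum>v\<in>W. \<Sum>X\<in>{X\<in>B. v \<in> X}. min 6 (card X)) =
      (\<Sum>X\<in>B. 8 * card (X \<inter> I)) + (\<Sum>X\<in>B. card (X \<inter> W) * min 6 (card X))"
  proof -
    \<comment> \<open>Each vertex of \<open>I\<close> lies in exactly one block, so its inner sum is
      a single 8.\<close>
    have "(\<Sum>X\<in>B. card (X \<inter> I) * 8) = (\<Sum>v\<in>I. 8)"
      unfolding sum_incidences_swap[OF fin(2) fin_B] by (intro sum.cong) (auto simp: I_def)
    then show ?thesis
      unfolding sum_incidences_swap[OF fin(3) fin_B, symmetric] by (simp add: mult.commute)
  qed
  also have "\<dots> \<le> (\<Sum>X\<in>B. 4 * edge_count H X)"
    unfolding sum.distrib[symmetric] by (intro sum_mono block)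
  finally have charged: "8 * card I + (\<Sum>v\<in>W. \<Sum>X\<in>{X\<in>B. v \<in> X}. min 6 (card X))
      \<le> 4 * sum (edge_count H) B"
    by (simp add: sum_distrib_left)

  have "8 * card W = (\<Sum>v\<in>W. 8)"
    by simp
  also have "\<dots> \<le> (\<Sum>v\<in>W. (\<Sum>X\<in>{X\<in>B. v \<in> X}. min 6 (card X)) +
      (if v \<in> looped_vertices G then 4 else 0))"
  proof (intro sum_mono incident_blocks_weight)
    fix v assume "v \<in> W"
    then show "6 \<le> (\<Sum>X\<in>{X\<in>B. v \<in> X}. card X - 1) + (if v \<in> looped_vertices G then 1 else 0)"
      "v \<in> looped_vertices G \<or> card {X\<in>B. v \<in> X} \<noteq> 1"
      using degree by (auto simp: W_def I_def)
  qed (use fin_B BV(2) in auto)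
  also have "\<dots> = (\<Sum>v\<in>W. \<Sum>X\<in>{X\<in>B. v \<in> X}. min 6 (card X)) + 4 * card (W \<inter> looped_vertices G)"
    by (simp add: sum.distrib sum.inter_restrict[OF fin(3), symmetric])
  also have "card (W \<inter> looped_vertices G) \<le> card UL"
    using fin(4) by (intro card_mono) (auto simp: W_def UL_def)
  finally have "8 * card W + 8 * card I \<le> 4 * sum (edge_count H) B + 4 * card UL"
    using charged by simp
  moreover have "card W + card I = card U"
    using fin card_Diff_subset[of I U] card_mono[of U I] by (auto simp: W_def I_def)
  moreover have "card U + card Z = card V"
    using fin_V ZV card_Diff_subset[of Z V] card_mono[of V Z] finite_subset[OF ZV]
    by (auto simp: U_def)
  \<comment> \<open>Division by 4 gives \<open>2 * card U\<close> within the blocks and loops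
    outside \<open>Z\<close>; the tight set \<open>Z\<close> contributes the remaining
    \<open>2 * card Z\<close>.\<close>
  ultimately have "2 * card V \<le> edge_count H V + loop_count H V"
    using edges_V loops_V Z by (simp add: loop_tight_def)
  then show ?thesis
    using sparse_graphD(3)[OF H(1), of V] by (simp add: loop_tight_def V_def H(2))
qed

text \<open>Choose a sparse spanning subgraph with as many edges and loops as possible. Whatever
  cannot be added to it is blocked by a tight set, so the discharging argument applies.\<close>

lemma balanced_imp_tight_subgraph:
  assumes G: "looped_simple_graph G" "balanced 6 G"
  obtains F K where "F \<subseteq> edges G" "K \<subseteq> loops G" "sparse_graph (G\<lparr>edges := F, loops := K\<rparr>)"
    "card F + card K = 2 * card (vertices G)"
proof -
  note G' = looped_simple_graphD[OF G(1)]
  define P where "P = {(F, K). F \<subseteq> edges G \<and> K \<subseteq> loops G \<and> sparse_graph (G\<lparr>edges := F, loops := K\<rparr>)}"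
  define size where "size = (\<lambda>(F :: 'a set set, K :: 'b set). card F + card K)"
  have "P \<subseteq> Pow (edges G) \<times> Pow (loops G)"
    by (auto simp: P_def)
  then have fin_P: "finite P"
    using G' finite_subset by fastforce
  have "({}, {}) \<in> P"
    using G(1) by (auto simp: P_def sparse_graph_def looped_simple_graph_def edge_count_def loop_count_def)
  then have "Max (size ` P) \<in> size ` P"
    using fin_P by (intro Max_in) auto
  then obtain F K where FK: "(F, K) \<in> P" and max: "Max (size ` P) = size (F, K)"
    by auto
  have max: "card F' + card K' \<le> card F + card K" if "(F', K') \<in> P" for F' K'
  proof -
    have "size (F', K') \<le> Max (size ` P)"
      using fin_P that by (intro Max_ge) auto
    then show ?thesis
      unfolding max by (simp add: size_def)
  qed
  define H where "H = G\<lparr>edges := F, loops := K\<rparr>"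
  have H: "sparse_graph H" "vertices H = vertices G" "loop_vertex H = loop_vertex G"
    using FK by (auto simp: P_def H_def)
  have FK': "F \<subseteq> edges G" "K \<subseteq> loops G" "finite F" "finite K"
    using FK G' finite_subset by (auto simp: P_def)
  have "loop_tight H (vertices G)"
  proof (rule balanced_imp_loop_tight[OF G H])
    fix e assume e: "e \<in> edges G"
    have "\<not> (e \<notin> F \<and> sparse_graph (H\<lparr>edges := insert e (edges H)\<rparr>))"
    proof
      assume *: "e \<notin> F \<and> sparse_graph (H\<lparr>edges := insert e (edges H)\<rparr>)"
      moreover have "H\<lparr>edges := insert e (edges H)\<rparr> = G\<lparr>edges := insert e F, loops := K\<rparr>"
        by (cases G) (simp add: H_def)
      ultimately have "(insert e F, K) \<in> P"
        using FK' e by (simp add: P_def)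
      then show False
        using max[of "insert e F" K] FK' * by simp
    qed
    then show "\<exists>X. e \<subseteq> X \<and> (edge_tight H X \<or> loop_tight H X)"
      using insert_edge_sparse_or_tight[OF H(1), of e] G'(4,5)[OF e] by (auto simp: H_def)
  next
    fix l assume l: "l \<in> loops G" "l \<notin> loops H"
    \<comment> \<open>The update of \<open>loop_vertex\<close> changes nothing here, since
      \<open>H\<close> inherits the map from \<open>G\<close>.\<close>
    have "\<not> sparse_graph (H\<lparr>loops := insert l (loops H), loop_vertex := (loop_vertex H)(l := loop_vertex G l)\<rparr>)"
    proof
      assume "sparse_graph (H\<lparr>loops := insert l (loops H), loop_vertex := (loop_vertex H)(l := loop_vertex G l)\<rparr>)"
      then have "(F, insert l K) \<in> P"
        using FK' l by (simp add: P_def H_def)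
      then show False
        using max[of F "insert l K"] FK' l by (simp add: H_def)
    qed
    then show "\<exists>X. loop_vertex G l \<in> X \<and> loop_tight H X"
      using insert_loop_sparse_or_tight[OF H(1), of "loop_vertex G l" l] G'(6)[OF l(1)] l
      by (auto simp: H_def)
  qed
  moreover have "edge_count H (vertices G) = card F" "loop_count H (vertices G) = card K"
  proof -
    have "{e \<in> F. e \<subseteq> vertices G} = F" "{l \<in> K. loop_vertex G l \<in> vertices G} = K"
      using FK'(1,2) G'(4) G'(6) by auto
    then show "edge_count H (vertices G) = card F" "loop_count H (vertices G) = card K"
      by (simp_all add: edge_count_def loop_count_def H_def)
  qed
  ultimately show thesis
    using that FK by (auto simp: P_def loop_tight_def)
qed

section \<open>Infinitesimal rigidity\<close>

text \<open>Velocities preserving all edge and loop constraints to first order: the kernel of the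
  rigidity matrix written as functions on vertices.\<close>

definition inf_motion ::
  "('v, 'l) looped_graph \<Rightarrow> ('v \<Rightarrow> real^2) \<Rightarrow> ('l \<Rightarrow> real^2) \<Rightarrow> ('v \<Rightarrow> real^2) \<Rightarrow> bool" where
  "inf_motion G p q \<mu> \<longleftrightarrow>
     (\<forall>a b. {a, b} \<in> edges G \<longrightarrow> inner (p a - p b) (\<mu> a - \<mu> b) = 0) \<and>
     (\<forall>l\<in>loops G. inner (q l) (\<mu> (loop_vertex G l)) = 0)"

text \<open>No trivial motions are factored out, because rank \<open>2 * card (vertices G)\<close>
  means a trivial kernel. Velocities off the vertex set are unconstrained.\<close>

definition inf_rigid ::
  "('v, 'l) looped_graph \<Rightarrow> ('v \<Rightarrow> real^2) \<Rightarrow> ('l \<Rightarrow> real^2) \<Rightarrow> bool" where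
  "inf_rigid G p q \<longleftrightarrow> (\<forall>\<mu>. inf_motion G p q \<mu> \<longrightarrow> (\<forall>v\<in>vertices G. \<mu> v = 0))"

section \<open>Motions as kernel vectors\<close>

text \<open>Uses the column order of \<open>rigidity_matrix\<close>, so that multiplication by the
  matrix evaluates the constraints.\<close>

definition motion_vec :: "('v, 'l) looped_graph \<Rightarrow> ('v \<Rightarrow> real^2) \<Rightarrow> real vec" where
  "motion_vec G \<mu> = vec (2 * card (vertices G))
     (\<lambda>j. let w = enumeration (vertices G) ! (j div 2) in if even j then \<mu> w $ 1 else \<mu> w $ 2)"

lemma rigidity_matrix_carrier:
  "rigidity_matrix G p q \<in> carrier_mat (card (edges G) + card (loops G)) (2 * card (vertices G))"
  by (simp add: rigidity_matrix_def)

lemma motion_vec_carrier: "motion_vec G \<mu> \<in> carrier_vec (2 * card (vertices G))"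
  by (simp add: motion_vec_def)

text \<open>Groups the two coordinate columns of each vertex, turning a scalar product into a sum of
  inner products.\<close>

lemma sum_lessThan_double:
  fixes f :: "nat \<Rightarrow> 'a :: comm_monoid_add"
  shows "(\<Sum>j<2 * n. f j) = (\<Sum>k<n. f (2 * k) + f (2 * k + 1))"
  by (induction n) (auto simp: add.assoc)

lemma inner_real2: "inner x (y :: real^2) = x $ 1 * y $ 1 + x $ 2 * y $ 2"
  by (simp add: inner_vec_def sum_2)

lemma edge_row_inner:
  assumes "finite V" "a \<in> V" "b \<in> V" "a \<noteq> b"
  shows "(\<Sum>w\<in>V. inner (edge_block p {a, b} w) (\<mu> w)) = inner (p a - p b) (\<mu> a - \<mu> b)"
proof -
  have "(\<Sum>w\<in>V. inner (edge_block p {a, b} w) (\<mu> w)) =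
      (\<Sum>w\<in>{a, b}. inner (edge_block p {a, b} w) (\<mu> w))"
    using assms by (intro sum.mono_neutral_right) (auto simp: edge_block_def)
  also have "\<dots> = inner (p a - p b) (\<mu> a) + inner (p b - p a) (\<mu> b)"
    using assms(4) edge_block_pair(1,2)[OF assms(4), of p] by simp
  also have "\<dots> = inner (p a - p b) (\<mu> a - \<mu> b)"
    by (simp add: inner_diff_left inner_diff_right)
  finally show ?thesis .
qed

lemma loop_row_inner:
  assumes "finite V" "loop_vertex G l \<in> V"
  shows "(\<Sum>w\<in>V. inner (loop_block G q l w) (\<mu> w)) = inner (q l) (\<mu> (loop_vertex G l))"
proof -
  have "(\<Sum>w\<in>V. inner (loop_block G q l w) (\<mu> w)) =
      (\<Sum>w\<in>V. if w = loop_vertex G l then inner (q l) (\<mu> w) else 0)"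
    by (intro sum.cong) (auto simp: loop_block_def)
  then show ?thesis
    using assms by simp
qed

lemma rigidity_matrix_mult_index:
  assumes "looped_simple_graph G" "i < card (edges G) + card (loops G)"
  shows "vec_index (rigidity_matrix G p q *\<^sub>v motion_vec G \<mu>) i =
    (\<Sum>w\<in>vertices G. inner
      (if i < card (edges G) then edge_block p (enumeration (edges G) ! i) w
       else loop_block G q (enumeration (loops G) ! (i - card (edges G))) w) (\<mu> w))"
proof -
  let ?n = "card (vertices G)"
  let ?vs = "enumeration (vertices G)"
  let ?b = "\<lambda>w. if i < card (edges G) then edge_block p (enumeration (edges G) ! i) w
       else loop_block G q (enumeration (loops G) ! (i - card (edges G))) w"
  have "finite (vertices G)"
    using assms(1) by (simp add: looped_simple_graph_def)
  note vs = enumeration[OF this]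
  have "vec_index (rigidity_matrix G p q *\<^sub>v motion_vec G \<mu>) i =
      (\<Sum>j<2 * ?n. rigidity_matrix G p q $$ (i, j) * vec_index (motion_vec G \<mu>) j)"
    using assms(2)
    by (simp add: scalar_prod_def motion_vec_def rigidity_matrix_def lessThan_atLeast0)
  also have "\<dots> = (\<Sum>k<?n. inner (?b (?vs ! k)) (\<mu> (?vs ! k)))"
    unfolding sum_lessThan_double
    using assms(2) by (intro sum.cong) (auto simp: rigidity_matrix_def motion_vec_def inner_real2 Let_def)
  also have "\<dots> = (\<Sum>w\<in>vertices G. inner (?b w) (\<mu> w))"
  proof (rule sum.reindex_bij_betw)
    show "bij_betw ((!) ?vs) {..<?n} (vertices G)"
      using bij_betw_nth[OF vs(1), of "{..<?n}" "vertices G"] vs by simp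
  qed
  finally show ?thesis .
qed

lemma rigidity_matrix_kernel:
  assumes "looped_simple_graph G"
  shows "rigidity_matrix G p q *\<^sub>v motion_vec G \<mu> = 0\<^sub>v (card (edges G) + card (loops G))
    \<longleftrightarrow> inf_motion G p q \<mu>"
proof -
  let ?m = "card (edges G)" and ?k = "card (loops G)"
  let ?x = "rigidity_matrix G p q *\<^sub>v motion_vec G \<mu>"
  have fin: "finite (vertices G)" "finite (edges G)" "finite (loops G)"
    using assms by (auto simp: looped_simple_graph_def intro: finite_subset[of _ "Pow (vertices G)"])
  note es = enumeration[OF fin(2)] and ls = enumeration[OF fin(3)]
  have edge: "(\<Sum>w\<in>vertices G. inner (edge_block p {a, b} w) (\<mu> w)) = inner (p a - p b) (\<mu> a - \<mu> b)"
    if "{a, b} \<in> edges G" for a b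
  proof -
    have "{a, b} \<subseteq> vertices G" "card {a, b} = 2"
      using assms that by (auto simp: looped_simple_graph_def)
    then show ?thesis
      by (intro edge_row_inner fin) auto
  qed
  have loop: "(\<Sum>w\<in>vertices G. inner (loop_block G q l w) (\<mu> w)) = inner (q l) (\<mu> (loop_vertex G l))"
    if "l \<in> loops G" for l
    using assms that by (intro loop_row_inner fin) (auto simp: looped_simple_graph_def)
  have "?x = 0\<^sub>v (?m + ?k) \<longleftrightarrow> (\<forall>i<?m + ?k. vec_index ?x i = 0)"
  proof
    assume "\<forall>i<?m + ?k. vec_index ?x i = 0"
    then show "?x = 0\<^sub>v (?m + ?k)"
      using rigidity_matrix_carrier[of G p q] by (intro eq_vecI) auto
  qed auto
  also have "\<dots> \<longleftrightarrow>
      (\<forall>i<?m. (\<Sum>w\<in>vertices G. inner (edge_block p (enumeration (edges G) ! i) w) (\<mu> w)) = 0) \<and>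
      (\<forall>i<?k. (\<Sum>w\<in>vertices G. inner (loop_block G q (enumeration (loops G) ! i) w) (\<mu> w)) = 0)"
    (is "?L \<longleftrightarrow> ?R1 \<and> ?R2")
  proof (intro iffI conjI allI impI)
    fix i assume ?L "i < ?m"
    then show "(\<Sum>w\<in>vertices G. inner (edge_block p (enumeration (edges G) ! i) w) (\<mu> w)) = 0"
      using rigidity_matrix_mult_index[OF assms, of i p q \<mu>] by auto
  next
    fix i assume ?L "i < ?k"
    then show "(\<Sum>w\<in>vertices G. inner (loop_block G q (enumeration (loops G) ! i) w) (\<mu> w)) = 0"
      using rigidity_matrix_mult_index[OF assms, of "?m + i" p q \<mu>] by auto
  next
    fix i assume R: "?R1 \<and> ?R2" and i: "i < ?m + ?k"
    show "vec_index ?x i = 0"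
    proof (cases "i < ?m")
      case True
      then show ?thesis
        using rigidity_matrix_mult_index[OF assms i, of p q \<mu>] R by simp
    next
      case False
      then have "i - ?m < ?k"
        using i by simp
      then show ?thesis
        using rigidity_matrix_mult_index[OF assms i, of p q \<mu>] R False by simp
    qed
  qed
  also have "?R1 \<longleftrightarrow> (\<forall>e\<in>edges G. (\<Sum>w\<in>vertices G. inner (edge_block p e w) (\<mu> w)) = 0)"
    using all_set_conv_all_nth[of "enumeration (edges G)"] es by simp
  also have "\<dots> \<longleftrightarrow> (\<forall>a b. {a, b} \<in> edges G \<longrightarrow> inner (p a - p b) (\<mu> a - \<mu> b) = 0)"
  proof
    assume *: "\<forall>a b. {a, b} \<in> edges G \<longrightarrow> inner (p a - p b) (\<mu> a - \<mu> b) = 0"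
    show "\<forall>e\<in>edges G. (\<Sum>w\<in>vertices G. inner (edge_block p e w) (\<mu> w)) = 0"
    proof
      fix e assume e: "e \<in> edges G"
      then have "card e = 2"
        using assms by (auto simp: looped_simple_graph_def)
      then obtain a b where "e = {a, b}"
        by (auto simp: card_2_iff)
      then show "(\<Sum>w\<in>vertices G. inner (edge_block p e w) (\<mu> w)) = 0"
        using e edge * by simp
    qed
  qed (use edge in auto)
  also have "?R2 \<longleftrightarrow> (\<forall>l\<in>loops G. (\<Sum>w\<in>vertices G. inner (loop_block G q l w) (\<mu> w)) = 0)"
    using all_set_conv_all_nth[of "enumeration (loops G)"] ls by simp
  also have "\<dots> \<longleftrightarrow> (\<forall>l\<in>loops G. inner (q l) (\<mu> (loop_vertex G l)) = 0)"
    using loop by auto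
  finally show ?thesis
    by (simp add: inf_motion_def)
qed

lemma motion_vec_eq_0:
  assumes "finite (vertices G)"
  shows "motion_vec G \<mu> = 0\<^sub>v (2 * card (vertices G)) \<longleftrightarrow> (\<forall>v\<in>vertices G. \<mu> v = 0)"
proof
  note vs = enumeration[OF assms]
  assume 0: "motion_vec G \<mu> = 0\<^sub>v (2 * card (vertices G))"
  show "\<forall>v\<in>vertices G. \<mu> v = 0"
  proof
    fix v assume "v \<in> vertices G"
    then obtain k where k: "k < card (vertices G)" "enumeration (vertices G) ! k = v"
      using vs by (metis in_set_conv_nth)
    have "vec_index (motion_vec G \<mu>) (2 * k) = 0" "vec_index (motion_vec G \<mu>) (2 * k + 1) = 0"
      using k unfolding 0 by auto
    then show "\<mu> v = 0"
      using k by (simp add: motion_vec_def Finite_Cartesian_Product.vec_eq_iff forall_2)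
  qed
next
  note vs = enumeration[OF assms]
  assume *: "\<forall>v\<in>vertices G. \<mu> v = 0"
  have "\<mu> (enumeration (vertices G) ! (j div 2)) = 0" if "j < 2 * card (vertices G)" for j
  proof -
    have "enumeration (vertices G) ! (j div 2) \<in> set (enumeration (vertices G))"
      using that vs(3) by (intro nth_mem) auto
    then show ?thesis
      using * vs(2) by auto
  qed
  then show "motion_vec G \<mu> = 0\<^sub>v (2 * card (vertices G))"
    by (intro eq_vecI) (auto simp: motion_vec_def Let_def)
qed

lemma motion_vec_surj:
  assumes "finite (vertices G)" "x \<in> carrier_vec (2 * card (vertices G))"
  obtains \<mu> where "x = motion_vec G \<mu>"
proof -
  note vs = enumeration[OF assms(1)]
  let ?vs = "enumeration (vertices G)"
  \<comment> \<open>\<open>k\<close> inverts the enumeration of the vertices, which locates the two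
    coordinates of a given vertex.\<close>
  define k where "k v = (THE k. k < card (vertices G) \<and> ?vs ! k = v)" for v
  have k: "k (?vs ! i) = i" if "i < card (vertices G)" for i
    unfolding k_def using that vs by (intro the_equality) (auto simp: nth_eq_iff_index_eq)
  define \<mu> :: "'a \<Rightarrow> real^2" where
    "\<mu> v = vector [vec_index x (2 * k v), vec_index x (2 * k v + 1)]" for v
  have "x = motion_vec G \<mu>"
    using assms(2) by (auto intro!: eq_vecI simp: motion_vec_def \<mu>_def k Let_def elim!: oddE)
  then show thesis
    by (rule that)
qed

lemma inf_rigid_iff_kernel:
  assumes "looped_simple_graph G"
  shows "inf_rigid G p q \<longleftrightarrow>
    (\<forall>x. x \<in> carrier_vec (2 * card (vertices G)) \<longrightarrow>
       rigidity_matrix G p q *\<^sub>v x = 0\<^sub>v (card (edges G) + card (loops G)) \<longrightarrow>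
       x = 0\<^sub>v (2 * card (vertices G)))"
proof -
  have fin: "finite (vertices G)"
    using assms by (simp add: looped_simple_graph_def)
  have "inf_rigid G p q \<longleftrightarrow> (\<forall>\<mu>.
      rigidity_matrix G p q *\<^sub>v motion_vec G \<mu> = 0\<^sub>v (card (edges G) + card (loops G)) \<longrightarrow>
      motion_vec G \<mu> = 0\<^sub>v (2 * card (vertices G)))"
    by (simp add: inf_rigid_def rigidity_matrix_kernel[OF assms] motion_vec_eq_0[OF fin])
  then show ?thesis
    using motion_vec_surj[OF fin] motion_vec_carrier[of G] by metis
qed

section \<open>Full rank and openness of rigidity\<close>

text \<open>A dependence among the columns is a nonzero kernel vector. Independence concerns the set
  of columns, so repeated columns are excluded first: they would put a difference of two unit
  vectors into the kernel.\<close>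

lemma full_rank_if_trivial_kernel:
  fixes A :: "real mat"
  assumes A: "A \<in> carrier_mat m n"
    and ker: "\<And>x. x \<in> carrier_vec n \<Longrightarrow> A *\<^sub>v x = 0\<^sub>v m \<Longrightarrow> x = 0\<^sub>v n"
  shows "vec_space.rank m A = n"
proof -
  interpret vec_space "TYPE(real)" m .
  have dist: "distinct (cols A)"
  proof (rule ccontr)
    assume "\<not> distinct (cols A)"
    then obtain i j where ij: "i < n" "j < n" "i \<noteq> j" "col A i = col A j"
      using A by (auto simp: distinct_conv_nth)
    let ?x = "unit_vec n i - unit_vec n j :: real vec"
    have col: "A *\<^sub>v unit_vec n k = col A k" if "k < n" for k
      using A that by (intro eq_vecI) auto
    have "A *\<^sub>v ?x = A *\<^sub>v unit_vec n i - A *\<^sub>v unit_vec n j"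
      using A by (intro mult_minus_distrib_mat_vec) auto
    also have "\<dots> = 0\<^sub>v m"
      using A ij col by auto
    finally have "?x = 0\<^sub>v n"
      by (intro ker) auto
    then have "vec_index ?x i = 0"
      using ij by simp
    then show False
      using ij by simp
  qed
  have "lin_indpt (set (cols A))"
    using lin_depE[OF A _ dist] ker by metis
  then show ?thesis
    by (rule lin_indpt_full_rank[OF A dist])
qed

lemma inf_rigid_imp_rigid:
  assumes "looped_simple_graph G" "inf_rigid G p q"
  shows "rigid G"
proof -
  have "vec_space.rank (card (edges G) + card (loops G)) (rigidity_matrix G p q)
      = 2 * card (vertices G)"
    using assms inf_rigid_iff_kernel[OF assms(1), of p q]
    by (intro full_rank_if_trivial_kernel[OF rigidity_matrix_carrier]) blast
  then show ?thesis
    unfolding rigid_def by blast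
qed

text \<open>By the Leibniz formula the determinant is a polynomial in the entries.\<close>

lemma continuous_det:
  fixes A :: "'a :: topological_space \<Rightarrow> real mat"
  assumes "\<And>t. A t \<in> carrier_mat n n"
    and "\<And>i j. i < n \<Longrightarrow> j < n \<Longrightarrow> continuous_on UNIV (\<lambda>t. A t $$ (i, j))"
  shows "continuous_on UNIV (\<lambda>t. Determinant.det (A t))"
proof -
  have "(\<lambda>t. Determinant.det (A t)) =
      (\<lambda>t. \<Sum>p \<in> {p. p permutes {0..<n}}. signof p * (\<Prod>i = 0..<n. A t $$ (i, p i)))"
    using det_def'[OF assms(1)] by auto
  moreover have "continuous_on UNIV
      (\<lambda>t. \<Sum>p \<in> {p. p permutes {0..<n}}. signof p * (\<Prod>i = 0..<n. A t $$ (i, p i)))"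
  proof (intro continuous_intros assms(2))
    fix p i assume "p \<in> {p. p permutes {0..<n}}" "i \<in> {0..<n}"
    then show "i < n" "p i < n"
      using permutes_in_image[of p "{0..<n}" i] by auto
  qed
  ultimately show ?thesis
    by (simp only:)
qed

text \<open>For a square rigidity matrix, rigidity is the nonvanishing of a determinant that varies
  continuously along the line with direction \<open>d\<close>, \<open>c\<close>.\<close>

lemma inf_rigid_perturb:
  fixes p d :: "'v \<Rightarrow> real^2" and q c :: "'l \<Rightarrow> real^2"
  assumes "looped_simple_graph G" "card (edges G) + card (loops G) = 2 * card (vertices G)"
    and "inf_rigid G p q"
  shows "\<forall>\<^sub>F t in at 0. inf_rigid G (\<lambda>v. p v + t *\<^sub>R d v) (\<lambda>l. q l + t *\<^sub>R c l)"
proof -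
  let ?n = "2 * card (vertices G)"
  let ?A = "\<lambda>t. rigidity_matrix G (\<lambda>v. p v + t *\<^sub>R d v) (\<lambda>l. q l + t *\<^sub>R c l)"
  have carrier: "rigidity_matrix G p q \<in> carrier_mat ?n ?n" for p q
    using rigidity_matrix_carrier[of G p q] assms(2) by simp
  have det: "inf_rigid G p q \<longleftrightarrow> Determinant.det (rigidity_matrix G p q) \<noteq> 0" for p q
    unfolding inf_rigid_iff_kernel[OF assms(1)] assms(2) det_0_iff_vec_prod_zero[OF carrier]
    by blast
  have edge_cont: "continuous_on UNIV (\<lambda>t. edge_block (\<lambda>v. p v + t *\<^sub>R d v) e w)" for e w
    by (cases "w \<in> e") (auto simp: edge_block_def intro!: continuous_intros)
  have loop_cont: "continuous_on UNIV (\<lambda>t. loop_block G (\<lambda>l. q l + t *\<^sub>R c l) l w)" for l w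
    by (cases "w = loop_vertex G l") (auto simp: loop_block_def intro!: continuous_intros)
  have "continuous_on UNIV (\<lambda>t. Determinant.det (?A t))"
  proof (rule continuous_det[OF carrier])
    fix i j assume ij: "i < ?n" "j < ?n"
    show "continuous_on UNIV (\<lambda>t. ?A t $$ (i, j))"
      using ij assms(2) edge_cont loop_cont
      by (cases "even j"; cases "i < card (edges G)")
        (auto simp: rigidity_matrix_def Let_def intro!: continuous_intros)
  qed
  then have "((\<lambda>t. Determinant.det (?A t)) \<longlongrightarrow> Determinant.det (?A 0)) (at 0)"
    unfolding continuous_on_def by blast
  moreover have "Determinant.det (?A 0) \<noteq> 0"
    using assms(3) det[of p q] by simp
  ultimately have "\<forall>\<^sub>F t in at 0. Determinant.det (?A t) \<noteq> 0"
    by (rule tendsto_imp_eventually_ne)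
  then show ?thesis
    unfolding det .
qed

section \<open>Vertex removal in tight graphs\<close>

text \<open>The second condition makes the rigidity matrix square.\<close>

definition tight_graph :: "('v, 'l) looped_graph \<Rightarrow> bool" where
  "tight_graph G \<longleftrightarrow> sparse_graph G \<and> card (edges G) + card (loops G) = 2 * card (vertices G)"

definition neighbours :: "('v, 'l) looped_graph \<Rightarrow> 'v \<Rightarrow> 'v set" where
  "neighbours G v = {w. {v, w} \<in> edges G}"

definition loops_at :: "('v, 'l) looped_graph \<Rightarrow> 'v \<Rightarrow> 'l set" where
  "loops_at G v = {l \<in> loops G. loop_vertex G l = v}"

lemma delete_vertices_sel [simp]:
  "vertices (delete_vertices G T) = vertices G - T"
  "edges (delete_vertices G T) = {e \<in> edges G. e \<inter> T = {}}"
  "loops (delete_vertices G T) = {l \<in> loops G. loop_vertex G l \<notin> T}"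
  "loop_vertex (delete_vertices G T) = loop_vertex G"
  by (simp_all add: delete_vertices_def)

lemma delete_vertices_count:
  assumes "X \<inter> T = {}"
  shows "edge_count (delete_vertices G T) X = edge_count G X"
    "loop_count (delete_vertices G T) X = loop_count G X"
proof -
  have "{e \<in> edges (delete_vertices G T). e \<subseteq> X} = {e \<in> edges G. e \<subseteq> X}"
    "{l \<in> loops (delete_vertices G T). loop_vertex (delete_vertices G T) l \<in> X} =
      {l \<in> loops G. loop_vertex G l \<in> X}"
    using assms by auto
  then show "edge_count (delete_vertices G T) X = edge_count G X"
    "loop_count (delete_vertices G T) X = loop_count G X"
    unfolding edge_count_def loop_count_def by simp_all
qed

lemma sparse_delete_vertices:
  assumes "sparse_graph G"
  shows "sparse_graph (delete_vertices G T)"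
proof -
  have "looped_simple_graph (delete_vertices G T)"
    using sparse_graphD(1)[OF assms] by (auto simp: looped_simple_graph_def)
  moreover have "X \<inter> T = {}" "X \<subseteq> vertices G" if "X \<subseteq> vertices (delete_vertices G T)" for X
    using that by auto
  ultimately show ?thesis
    using assms unfolding sparse_graph_def by (metis delete_vertices_count)
qed

lemma tight_delete_vertices:
  shows "edge_tight (delete_vertices G T) X \<longleftrightarrow> edge_tight G X \<and> X \<inter> T = {}"
    and "loop_tight (delete_vertices G T) X \<longleftrightarrow> loop_tight G X \<and> X \<inter> T = {}"
proof -
  have "X \<subseteq> vertices (delete_vertices G T) \<longleftrightarrow> X \<subseteq> vertices G \<and> X \<inter> T = {}"
    by auto
  then show "edge_tight (delete_vertices G T) X \<longleftrightarrow> edge_tight G X \<and> X \<inter> T = {}"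
    "loop_tight (delete_vertices G T) X \<longleftrightarrow> loop_tight G X \<and> X \<inter> T = {}"
    using delete_vertices_count[of X T G] unfolding edge_tight_def loop_tight_def by metis+
qed

lemma neighboursD:
  assumes "looped_simple_graph G" "w \<in> neighbours G v"
  shows "w \<in> vertices G" "w \<noteq> v"
proof -
  have "{v, w} \<subseteq> vertices G" "card {v, w} = 2"
    using looped_simple_graphD(4,5)[OF assms(1)] assms(2) by (auto simp: neighbours_def)
  then show "w \<in> vertices G" "w \<noteq> v"
    by auto
qed

lemma finite_neighbours: "looped_simple_graph G \<Longrightarrow> finite (neighbours G v)"
  by (rule finite_subset[OF _ looped_simple_graphD(1)]) (auto dest: neighboursD)

lemma finite_loops_at: "looped_simple_graph G \<Longrightarrow> finite (loops_at G v)"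
  using looped_simple_graphD(3)[of G] by (auto simp: loops_at_def)

lemma card_incident_edges:
  assumes "looped_simple_graph G"
  shows "card {e \<in> edges G. v \<in> e} = card (neighbours G v)"
proof -
  have "{e \<in> edges G. v \<in> e} = (\<lambda>w. {v, w}) ` neighbours G v"
  proof (intro equalityI subsetI)
    fix e assume e: "e \<in> {e \<in> edges G. v \<in> e}"
    then have "card e = 2"
      using looped_simple_graphD(5)[OF assms] by blast
    then obtain a b where "e = {a, b}"
      by (auto simp: card_2_iff)
    then show "e \<in> (\<lambda>w. {v, w}) ` neighbours G v"
      using e by (auto simp: neighbours_def insert_commute)
  qed (auto simp: neighbours_def)
  moreover have "inj_on (\<lambda>w. {v, w}) (neighbours G v)"
    by (auto simp: inj_on_def doubleton_eq_iff)
  ultimately show ?thesis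
    by (simp add: card_image)
qed

lemma edge_count_insert:
  assumes "looped_simple_graph G" "v \<notin> X" "M \<subseteq> neighbours G v" "M \<subseteq> X"
  shows "edge_count G X + card M \<le> edge_count G (insert v X)"
proof -
  have "finite M"
    using assms(3) finite_neighbours[OF assms(1)] finite_subset by blast
  have "card ({e \<in> edges G. e \<subseteq> X} \<union> (\<lambda>w. {v, w}) ` M) =
      card {e \<in> edges G. e \<subseteq> X} + card ((\<lambda>w. {v, w}) ` M)"
    using looped_simple_graphD(2)[OF assms(1)] \<open>finite M\<close> assms(2)
    by (intro card_Un_disjoint) auto
  also have "card ((\<lambda>w. {v, w}) ` M) = card M"
    by (intro card_image) (auto simp: inj_on_def doubleton_eq_iff)
  finally have "edge_count G X + card M = card ({e \<in> edges G. e \<subseteq> X} \<union> (\<lambda>w. {v, w}) ` M)"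
    by (simp add: edge_count_def)
  also have "\<dots> \<le> edge_count G (insert v X)"
    unfolding edge_count_def using looped_simple_graphD(2)[OF assms(1)] assms(3,4)
    by (intro card_mono) (auto simp: neighbours_def)
  finally show ?thesis .
qed

lemma loop_count_insert:
  assumes "looped_simple_graph G" "v \<notin> X"
  shows "loop_count G (insert v X) = loop_count G X + card (loops_at G v)"
proof -
  have "{l \<in> loops G. loop_vertex G l \<in> insert v X} =
      {l \<in> loops G. loop_vertex G l \<in> X} \<union> loops_at G v"
    by (auto simp: loops_at_def)
  then show ?thesis
    unfolding loop_count_def using looped_simple_graphD(3)[OF assms(1)] assms(2)
    by (auto simp: loops_at_def intro!: card_Un_disjoint)
qed

section \<open>Tight sets near a vertex and vertices of small degree\<close>

text \<open>Adding \<open>v\<close> to \<open>X\<close> raises the sparsity bound by only 2, and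
  \<open>X\<close> has already used up its own bound.\<close>

lemma edge_tight_neighbours_le:
  assumes "sparse_graph G" "edge_tight G X" "v \<in> vertices G" "v \<notin> X"
    "M \<subseteq> neighbours G v" "M \<subseteq> X"
  shows "card M \<le> 2"
proof -
  note G = looped_simple_graphD[OF sparse_graphD(1)[OF assms(1)]]
  have "finite X"
    using assms(2) G(1) finite_subset by (auto simp: edge_tight_def)
  then show ?thesis
    using edge_count_insert[OF sparse_graphD(1)[OF assms(1)] assms(4-6)] assms(2-4)
      sparse_graphD(2)[OF assms(1), of "insert v X"]
    by (auto simp: edge_tight_def)
qed

text \<open>As for edge-tight sets, except that the loops at \<open>v\<close> also consume the 2
  units gained.\<close>

lemma loop_tight_neighbours_le:
  assumes "sparse_graph G" "loop_tight G X" "v \<in> vertices G" "v \<notin> X"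
    "M \<subseteq> neighbours G v" "M \<subseteq> X"
  shows "card M + card (loops_at G v) \<le> 2"
proof -
  note G = looped_simple_graphD[OF sparse_graphD(1)[OF assms(1)]]
  have "finite X"
    using assms(2) G(1) finite_subset by (auto simp: loop_tight_def)
  then show ?thesis
    using edge_count_insert[OF sparse_graphD(1)[OF assms(1)] assms(4-6)] assms(2-4)
      loop_count_insert[OF sparse_graphD(1)[OF assms(1)] assms(4)]
      sparse_graphD(3)[OF assms(1), of "insert v X"]
    by (auto simp: loop_tight_def)
qed

lemma card_delete_vertex:
  assumes "looped_simple_graph G" "v \<in> vertices G"
  shows "card (vertices (delete_vertices G {v})) + 1 = card (vertices G)"
    "card (edges (delete_vertices G {v})) + card (neighbours G v) = card (edges G)"
    "card (loops (delete_vertices G {v})) + card (loops_at G v) = card (loops G)"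
proof -
  note G = looped_simple_graphD[OF assms(1)]
  show "card (vertices (delete_vertices G {v})) + 1 = card (vertices G)"
    using card_Suc_Diff1[OF G(1) assms(2)] by simp
  have "edges G = {e \<in> edges G. e \<inter> {v} = {}} \<union> {e \<in> edges G. v \<in> e}"
    by auto
  then have "card (edges G) = card ({e \<in> edges G. e \<inter> {v} = {}} \<union> {e \<in> edges G. v \<in> e})"
    by simp
  also have "\<dots> = card {e \<in> edges G. e \<inter> {v} = {}} + card {e \<in> edges G. v \<in> e}"
    using G(2) by (intro card_Un_disjoint) auto
  finally show "card (edges (delete_vertices G {v})) + card (neighbours G v) = card (edges G)"
    by (simp add: card_incident_edges[OF assms(1)])
  have "loops G = {l \<in> loops G. loop_vertex G l \<notin> {v}} \<union> loops_at G v"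
    by (auto simp: loops_at_def)
  then have "card (loops G) = card ({l \<in> loops G. loop_vertex G l \<notin> {v}} \<union> loops_at G v)"
    by simp
  also have "\<dots> = card {l \<in> loops G. loop_vertex G l \<notin> {v}} + card (loops_at G v)"
    using G(3) by (intro card_Un_disjoint) (auto simp: loops_at_def)
  finally show "card (loops (delete_vertices G {v})) + card (loops_at G v) = card (loops G)"
    by simp
qed

text \<open>Handshake count, in which a loop contributes one to the degree of its vertex.\<close>

lemma sum_degrees:
  assumes "looped_simple_graph G"
  shows "(\<Sum>v\<in>vertices G. card (neighbours G v) + card (loops_at G v)) =
    2 * card (edges G) + card (loops G)"
proof -
  note G = looped_simple_graphD[OF assms]
  have "(\<Sum>v\<in>vertices G. card (neighbours G v)) = (\<Sum>v\<in>vertices G. \<Sum>e\<in>{e\<in>edges G. v \<in> e}. 1)"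
    by (simp add: card_incident_edges[OF assms])
  also have "\<dots> = (\<Sum>e\<in>edges G. card (e \<inter> vertices G) * 1)"
    by (rule sum_incidences_swap[OF G(1,2), symmetric])
  also have "\<dots> = (\<Sum>e\<in>edges G. 2)"
    using G(4,5) by (intro sum.cong) (auto simp: Int_absorb2)
  finally have "(\<Sum>v\<in>vertices G. card (neighbours G v)) = 2 * card (edges G)"
    by simp
  moreover have "(\<Sum>v\<in>vertices G. card (loops_at G v)) = card (loops G)"
  proof -
    have "(\<Sum>v\<in>vertices G. card (loops_at G v)) = card (\<Union>v\<in>vertices G. loops_at G v)"
      using G(1) finite_loops_at[OF assms]
      by (intro card_UN_disjoint[symmetric]) (auto simp: loops_at_def)
    also have "(\<Union>v\<in>vertices G. loops_at G v) = loops G"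
      using G(6) by (auto simp: loops_at_def)
    finally show ?thesis .
  qed
  ultimately show ?thesis
    by (simp add: sum.distrib)
qed

text \<open>The degrees sum to \<open>4 * card (vertices G) - card (loops G)\<close>, so as soon as
  a loop exists some degree is below 4. The total count of a single vertex allows at most two loops
  there.\<close>

lemma tight_graph_small_degree:
  assumes "tight_graph G" "vertices G \<noteq> {}"
  obtains v where "v \<in> vertices G" "2 \<le> card (neighbours G v) + card (loops_at G v)"
    "card (neighbours G v) + card (loops_at G v) \<le> 3" "card (loops_at G v) \<le> 2"
proof -
  have sparse: "sparse_graph G" and tight: "card (edges G) + card (loops G) = 2 * card (vertices G)"
    using assms(1) by (auto simp: tight_graph_def)
  note simple = sparse_graphD(1)[OF sparse]
  note G = looped_simple_graphD[OF simple]
  have pos: "0 < card (vertices G)"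
    using G(1) assms(2) by (simp add: card_gt_0_iff)
  have counts: "edge_count H (vertices H) = card (edges H)" "loop_count H (vertices H) = card (loops H)"
    if "looped_simple_graph H" for H :: "('a, 'b) looped_graph"
  proof -
    have "{e \<in> edges H. e \<subseteq> vertices H} = edges H"
      "{l \<in> loops H. loop_vertex H l \<in> vertices H} = loops H"
      using looped_simple_graphD(4)[OF that] looped_simple_graphD(6)[OF that] by auto
    then show "edge_count H (vertices H) = card (edges H)" "loop_count H (vertices H) = card (loops H)"
      unfolding edge_count_def loop_count_def by simp_all
  qed
  \<comment> \<open>With two or more vertices the edges fall at least 3 short of the total; a single
    vertex has no edges at all.\<close>
  have "0 < card (loops G)"
  proof (cases "2 \<le> card (vertices G)")
    case True
    then show ?thesis
      using sparse_graphD(2)[OF sparse, of "vertices G"] tight counts[OF simple] by simp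
  next
    case False
    have "edges G = {}"
    proof (rule ccontr)
      assume "edges G \<noteq> {}"
      then obtain e where "e \<in> edges G" by blast
      then show False
        using G(4,5)[of e] card_mono[OF G(1), of e] False by simp
    qed
    then show ?thesis
      using tight pos by simp
  qed
  then have "(\<Sum>v\<in>vertices G. card (neighbours G v) + card (loops_at G v)) < (\<Sum>v\<in>vertices G. 4)"
    using sum_degrees[OF simple] tight by simp
  then obtain v where v: "v \<in> vertices G" "card (neighbours G v) + card (loops_at G v) < 4"
    by (meson linorder_not_le sum_mono)
  let ?H = "delete_vertices G {v}"
  have H: "sparse_graph ?H"
    by (rule sparse_delete_vertices[OF sparse])
  \<comment> \<open>Otherwise \<open>?H\<close> would keep more than
    \<open>2 * card (vertices ?H)\<close> edges and loops.\<close>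
  have "2 \<le> card (neighbours G v) + card (loops_at G v)"
    using sparse_graphD(3)[OF H order_refl] counts[OF sparse_graphD(1)[OF H]]
      card_delete_vertex[OF simple v(1)] tight by linarith
  moreover have "card (loops_at G v) \<le> 2"
    using sparse_graphD(3)[OF sparse, of "{v}"] v(1)
    by (simp add: loop_count_def loops_at_def)
  ultimately show thesis
    using that v by auto
qed

section \<open>Unblocked pairs of neighbours\<close>

text \<open>The sizes add up to that of the union plus 3, and the edges add up. Doubling gives a
  surplus of 6, which reduces three deficits of 3 to a single one, and cancels the two deficits that
  remain when \<open>A\<close> is loop-tight.\<close>

lemma tight_triangle:
  assumes "sparse_graph G" "edge_tight G A \<or> loop_tight G A" "edge_tight G B" "edge_tight G C"
    and AB: "A \<inter> B = {u}" and AC: "A \<inter> C = {w}" and BC: "B \<inter> C = {x}"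
    and "u \<noteq> w" "u \<noteq> x" "w \<noteq> x"
  shows "edge_tight G (A \<union> B \<union> C) \<or> loop_tight G (A \<union> B \<union> C)"
proof -
  note simple = sparse_graphD(1)[OF assms(1)]
  note G = looped_simple_graphD[OF simple]
  have sub: "A \<subseteq> vertices G" "B \<subseteq> vertices G" "C \<subseteq> vertices G"
    using assms by (auto simp: edge_tight_def loop_tight_def)
  then have fin: "finite A" "finite B" "finite C"
    using finite_subset[OF _ G(1)] by blast+
  have "card A + card B = card (A \<union> B) + 1"
    using card_Un_Int[OF fin(1,2)] AB by simp
  moreover have "card (A \<union> B) + card C = card (A \<union> B \<union> C) + 2"
  proof -
    have "(A \<union> B) \<inter> C = {w, x}"
      using AC BC by blast
    then show ?thesis
      using card_Un_Int[of "A \<union> B" C] fin assms(10) by simp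
  qed
  ultimately have card: "card A + card B + card C = card (A \<union> B \<union> C) + 3"
    by simp
  have ne: "A \<noteq> B" "A \<noteq> C" "B \<noteq> C"
    using assms by auto
  have "(\<Sum>X\<in>{A, B, C}. edge_count G X) \<le> edge_count G (\<Union>{A, B, C})"
    by (rule sum_edge_count_le[OF simple]) (use AB AC BC sub in \<open>auto simp: Int_commute\<close>)
  then have edges: "edge_count G A + edge_count G B + edge_count G C \<le> edge_count G (A \<union> B \<union> C)"
    using ne by (simp add: Un_assoc)
  have large: "2 \<le> card (A \<union> B \<union> C)"
  proof -
    have "card B \<le> card (A \<union> B \<union> C)"
      using fin by (intro card_mono) auto
    then show ?thesis
      using assms(3) by (simp add: edge_tight_def)
  qed
  from assms(2) show ?thesis
  proof
    assume "edge_tight G A"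
    then show ?thesis
      using assms(3,4) card edges large sub sparse_graphD(2)[OF assms(1), of "A \<union> B \<union> C"]
      by (auto simp: edge_tight_def)
  next
    assume "loop_tight G A"
    moreover have "loop_count G A \<le> loop_count G (A \<union> B \<union> C)"
      by (rule loop_count_mono[OF G(3)]) auto
    ultimately show ?thesis
      using assms(3,4) card edges sub sparse_graphD(3)[OF assms(1), of "A \<union> B \<union> C"]
      by (auto simp: edge_tight_def loop_tight_def)
  qed
qed

text \<open>If all three pairs of neighbours were blocked, uncrossing would produce a tight set that
  avoids \<open>v\<close> and contains all three, giving \<open>v\<close> too many edges into
  it.\<close>

lemma no_three_tight_sets:
  assumes "sparse_graph G" "v \<in> vertices G" "{u, w, x} \<subseteq> neighbours G v"
    and dist: "u \<noteq> w" "u \<noteq> x" "w \<noteq> x"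
    and A: "edge_tight G A \<or> loop_tight G A" "v \<notin> A" "{u, w} \<subseteq> A"
    and B: "edge_tight G B \<or> loop_tight G B" "v \<notin> B" "{u, x} \<subseteq> B"
    and C: "edge_tight G C \<or> loop_tight G C" "v \<notin> C" "{w, x} \<subseteq> C"
  shows False
proof -
  define T where "T X \<longleftrightarrow> edge_tight G X \<or> loop_tight G X" for X
  note simple = sparse_graphD(1)[OF assms(1)]
  have fin: "finite X" if "T X" for X
    using that looped_simple_graphD(1)[OF simple] finite_subset
    by (auto simp: T_def edge_tight_def loop_tight_def)
  have three: "card {u, w, x} = 3"
    using dist by simp
  have not_all: "\<not> {u, w, x} \<subseteq> X" if "T X" "v \<notin> X" for X
    using edge_tight_neighbours_le[OF assms(1) _ assms(2) that(2) assms(3)]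
      loop_tight_neighbours_le[OF assms(1) _ assms(2) that(2) assms(3)] that(1) three
    by (auto simp: T_def)
  have Un: "T (X \<union> Y)" if "T X" "T Y" "2 \<le> card (X \<inter> Y) \<or> loop_tight G X \<and> loop_tight G Y" for X Y
    using that edge_tight_Un[OF assms(1), of X Y] loop_tight_Un[OF assms(1), of X Y]
      loop_tight_Un_edge_tight[OF assms(1), of X Y] loop_tight_Un_edge_tight[OF assms(1), of Y X]
    unfolding T_def by (metis Int_commute Un_commute)
  \<comment> \<open>The union contains all three neighbours and so is not tight; hence none of the
    uncrossing lemmas may apply to \<open>X\<close> and \<open>Y\<close>.\<close>
  have pair: "X \<inter> Y = {a} \<and> \<not> (loop_tight G X \<and> loop_tight G Y)"
    if "T X" "T Y" "v \<notin> X" "v \<notin> Y" "a \<in> X \<inter> Y" "{u, w, x} \<subseteq> X \<union> Y" for X Y a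
  proof -
    have "\<not> T (X \<union> Y)"
      using not_all that by blast
    then have *: "card (X \<inter> Y) \<le> 1" "\<not> (loop_tight G X \<and> loop_tight G Y)"
      using Un[OF that(1,2)] by linarith+
    moreover have "finite (X \<inter> Y)"
      using fin[OF that(1)] by simp
    ultimately have "X \<inter> Y = {a}"
      using that(5) card_le_Suc0_iff_eq[of "X \<inter> Y"] by auto
    then show ?thesis
      using * by simp
  qed
  have T: "T A" "T B" "T C"
    using A B C by (auto simp: T_def)
  have AB: "A \<inter> B = {u} \<and> \<not> (loop_tight G A \<and> loop_tight G B)"
    using A(2,3) B(2,3) T by (intro pair) auto
  have AC: "A \<inter> C = {w} \<and> \<not> (loop_tight G A \<and> loop_tight G C)"
    using A(2,3) C(2,3) T by (intro pair) auto
  have BC: "B \<inter> C = {x} \<and> \<not> (loop_tight G B \<and> loop_tight G C)"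
    using B(2,3) C(2,3) T by (intro pair) auto
  have "T (A \<union> B \<union> C)"
  proof -
    \<comment> \<open>No two of the sets are both loop-tight, so at least two are edge-tight; the
      remaining one takes the first place in \<open>tight_triangle\<close>.\<close>
    consider "edge_tight G B" "edge_tight G C" | "edge_tight G A" "edge_tight G C"
      | "edge_tight G A" "edge_tight G B"
      using A(1) B(1) C(1) AB AC BC by blast
    then show ?thesis
    proof cases
      case 1
      then show ?thesis
        using tight_triangle[OF assms(1) A(1) 1, of u w x] AB AC BC dist by (auto simp: T_def)
    next
      case 2
      then have "T (B \<union> A \<union> C)"
        using tight_triangle[OF assms(1) B(1) 2, of u x w] AB AC BC dist
        by (auto simp: T_def Int_commute)
      then show ?thesis
        by (simp add: Un_commute)
    next
      case 3
      then have "T (C \<union> A \<union> B)"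
        using tight_triangle[OF assms(1) C(1) 3, of w x u] AB AC BC dist
        by (auto simp: T_def Int_commute)
      then show ?thesis
        by (simp add: Un_commute Un_left_commute)
    qed
  qed
  then show False
    using not_all[of "A \<union> B \<union> C"] A B C by auto
qed

section \<open>Tight graphs are infinitesimally rigid\<close>

text \<open>The determinant of the pair, nonzero exactly for linearly independent vectors.\<close>

definition cross2 :: "real^2 \<Rightarrow> real^2 \<Rightarrow> real" where
  "cross2 a b = a $ 1 * b $ 2 - a $ 2 * b $ 1"

text \<open>The counterclockwise quarter turn.\<close>

definition rot :: "real^2 \<Rightarrow> real^2" where
  "rot a = vector [- (a $ 2), a $ 1]"

text \<open>Cramer's rule: two independent rows at a vertex force its velocity to vanish.\<close>

lemma cross2_orthogonal_eq_0:
  assumes "cross2 a b \<noteq> 0" "inner a y = 0" "inner b y = 0"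
  shows "y = 0"
proof -
  have "cross2 a b * y $ 1 = b $ 2 * inner a y - a $ 2 * inner b y"
    "cross2 a b * y $ 2 = a $ 1 * inner b y - b $ 1 * inner a y"
    by (simp_all add: cross2_def inner_real2 algebra_simps)
  then show ?thesis
    using assms by (simp add: Finite_Cartesian_Product.vec_eq_iff forall_2)
qed

lemma cross2_rot: "cross2 a (rot a) = inner a a"
  by (simp add: cross2_def rot_def inner_real2)

lemma cross2_simps:
  "cross2 a a = 0" "cross2 a (b + c) = cross2 a b + cross2 a c"
  "cross2 (a + b) c = cross2 a c + cross2 b c"
  "cross2 a (b - c) = cross2 a b - cross2 a c"
  "cross2 (a - b) c = cross2 a c - cross2 b c"
  "cross2 (t *\<^sub>R a) b = t * cross2 a b" "cross2 a (t *\<^sub>R b) = t * cross2 a b"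
  by (simp_all add: cross2_def algebra_simps)

lemma cross2_commute: "cross2 a b = - cross2 b a"
  by (simp add: cross2_def)

section \<open>General position by perturbation\<close>

lemma inf_rigid_perturb_nonzero:
  fixes p d :: "'v \<Rightarrow> real^2" and q c :: "'l \<Rightarrow> real^2"
  assumes "tight_graph G" "inf_rigid G p q"
  obtains t where "t \<noteq> 0" "inf_rigid G (\<lambda>v. p v + t *\<^sub>R d v) (\<lambda>l. q l + t *\<^sub>R c l)"
proof -
  have "\<forall>\<^sub>F t in at 0. inf_rigid G (\<lambda>v. p v + t *\<^sub>R d v) (\<lambda>l. q l + t *\<^sub>R c l)"
    using assms by (intro inf_rigid_perturb) (auto simp: tight_graph_def sparse_graph_def)
  moreover have "\<forall>\<^sub>F t in at 0. t \<noteq> (0 :: real)"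
    by (simp add: eventually_at_filter)
  ultimately have "\<forall>\<^sub>F t in at 0. t \<noteq> 0 \<and>
      inf_rigid G (\<lambda>v. p v + t *\<^sub>R d v) (\<lambda>l. q l + t *\<^sub>R c l)"
    by eventually_elim simp
  then show thesis
    using that eventually_happens'[OF at_neq_bot] by blast
qed

text \<open>If the two points coincide, a small shift of \<open>u\<close> separates them and keeps
  the framework rigid.\<close>

lemma inf_rigid_generic_pair:
  fixes p :: "'v \<Rightarrow> real^2"
  assumes "tight_graph G" "inf_rigid G p q" "u \<noteq> w"
  obtains p' where "inf_rigid G p' q" "p' u \<noteq> p' w"
proof (cases "p u = p w")
  case True
  obtain t where t: "t \<noteq> 0" "inf_rigid G
      (\<lambda>v. p v + t *\<^sub>R (if v = u then axis 1 1 else 0)) (\<lambda>l. q l + t *\<^sub>R 0)"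
    using inf_rigid_perturb_nonzero[OF assms(1,2),
        of "\<lambda>v. if v = u then axis 1 1 else 0" "\<lambda>l. 0"] .
  then show thesis
    using assms(3) True by (intro that[of "\<lambda>v. p v + t *\<^sub>R (if v = u then axis 1 1 else 0)"]) auto
qed (use assms that in blast)

text \<open>Collinear points are repaired by moving \<open>x\<close> at right angles to the line
  through \<open>u\<close> and \<open>w\<close>; the cross product then changes by a nonzero
  multiple of a squared length.\<close>

lemma inf_rigid_generic_triple:
  fixes p :: "'v \<Rightarrow> real^2"
  assumes "tight_graph G" "inf_rigid G p q" "u \<noteq> w" "u \<noteq> x" "w \<noteq> x"
  obtains p' where "inf_rigid G p' q" "cross2 (p' u - p' w) (p' u - p' x) \<noteq> 0"
proof -
  obtain p1 where p1: "inf_rigid G p1 q" "p1 u \<noteq> p1 w"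
    using inf_rigid_generic_pair[OF assms(1-3)] .
  show thesis
  proof (cases "cross2 (p1 u - p1 w) (p1 u - p1 x) = 0")
    case True
    let ?d = "rot (p1 u - p1 w)"
    obtain t where t: "t \<noteq> 0" "inf_rigid G
        (\<lambda>v. p1 v + t *\<^sub>R (if v = x then ?d else 0)) (\<lambda>l. q l + t *\<^sub>R 0)"
      using inf_rigid_perturb_nonzero[OF assms(1) p1(1),
          of "\<lambda>v. if v = x then ?d else 0" "\<lambda>l. 0"] .
    have "cross2 (p1 u - p1 w) (p1 u - (p1 x + t *\<^sub>R ?d)) =
        cross2 (p1 u - p1 w) (p1 u - p1 x) - t * inner (p1 u - p1 w) (p1 u - p1 w)"
      unfolding cross2_rot[symmetric] by (simp add: cross2_simps algebra_simps)
    then have "cross2 (p1 u - p1 w) (p1 u - (p1 x + t *\<^sub>R ?d)) \<noteq> 0"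
      using True t(1) p1(2) by simp
    then show thesis
      using t assms(4,5) by (intro that[of "\<lambda>v. p1 v + t *\<^sub>R (if v = x then ?d else 0)"]) auto
  qed (use p1 that in blast)
qed

text \<open>Makes the direction of \<open>l\<close> independent of the line through \<open>u\<close>
  and \<open>w\<close> by adding a small normal component.\<close>

lemma inf_rigid_generic_loop:
  fixes p :: "'v \<Rightarrow> real^2"
  assumes "tight_graph G" "inf_rigid G p q" "u \<noteq> w"
  obtains p' q' where "inf_rigid G p' q'" "cross2 (q' l) (p' u - p' w) \<noteq> 0"
proof -
  obtain p1 where p1: "inf_rigid G p1 q" "p1 u \<noteq> p1 w"
    using inf_rigid_generic_pair[OF assms(1-3)] .
  show thesis
  proof (cases "cross2 (q l) (p1 u - p1 w) = 0")
    case True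
    let ?d = "rot (p1 u - p1 w)"
    obtain t where t: "t \<noteq> 0" "inf_rigid G
        (\<lambda>v. p1 v + t *\<^sub>R 0) (\<lambda>k. q k + t *\<^sub>R (if k = l then ?d else 0))"
      using inf_rigid_perturb_nonzero[OF assms(1) p1(1),
          of "\<lambda>v. 0" "\<lambda>k. if k = l then ?d else 0"] .
    have "cross2 (q l + t *\<^sub>R ?d) (p1 u - p1 w) =
        cross2 (q l) (p1 u - p1 w) - t * inner (p1 u - p1 w) (p1 u - p1 w)"
      unfolding cross2_rot[symmetric] cross2_commute[of _ ?d] cross2_simps(3,6) by simp
    then have "cross2 (q l + t *\<^sub>R ?d) (p1 u - p1 w) \<noteq> 0"
      using True t(1) p1(2) by simp
    then show thesis
      using t by (intro that[of p1 "\<lambda>k. q k + t *\<^sub>R (if k = l then ?d else 0)"]) auto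
  qed (use p1 that in blast)
qed

section \<open>Restricting motions to a graph without the vertex\<close>

lemma inf_motion_edge:
  "inf_motion G p q \<mu> \<Longrightarrow> w \<in> neighbours G v \<Longrightarrow> inner (p v - p w) (\<mu> v - \<mu> w) = 0"
  by (simp add: inf_motion_def neighbours_def)

lemma inf_motion_loop:
  "inf_motion G p q \<mu> \<Longrightarrow> l \<in> loops_at G v \<Longrightarrow> inner (q l) (\<mu> v) = 0"
  by (auto simp: inf_motion_def loops_at_def)

lemma inf_motion_delete_vertex:
  assumes "inf_motion G p q \<mu>" "\<And>w. w \<noteq> v \<Longrightarrow> p w = p' w"
    "\<And>l. l \<in> loops G \<Longrightarrow> loop_vertex G l \<noteq> v \<Longrightarrow> q l = q' l"
  shows "inf_motion (delete_vertices G {v}) p' q' \<mu>"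
  using assms(1) unfolding inf_motion_def
proof (elim conjE, intro conjI allI impI ballI)
  fix a b
  assume "{a, b} \<in> edges (delete_vertices G {v})"
    and *: "\<forall>a b. {a, b} \<in> edges G \<longrightarrow> inner (p a - p b) (\<mu> a - \<mu> b) = 0"
  then have "{a, b} \<in> edges G" "a \<noteq> v" "b \<noteq> v"
    by auto
  then show "inner (p' a - p' b) (\<mu> a - \<mu> b) = 0"
    using assms(2)[of a] assms(2)[of b] * by metis
next
  fix l
  assume "l \<in> loops (delete_vertices G {v})"
    and "\<forall>l\<in>loops G. inner (q l) (\<mu> (loop_vertex G l)) = 0"
  then show "inner (q' l) (\<mu> (loop_vertex (delete_vertices G {v}) l)) = 0"
    using assms(3)[of l] by auto
qed

text \<open>Common frame of the extension steps: a motion of \<open>G\<close> is one of the smaller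
  rigid framework \<open>H\<close>, so it vanishes off \<open>v\<close>, and the constraints at
  \<open>v\<close> then pin \<open>v\<close> too.\<close>

lemma inf_rigid_extend:
  assumes "inf_rigid H p' q'" "vertices H = vertices G - {v}"
    and "\<And>\<mu>. inf_motion G p q \<mu> \<Longrightarrow> inf_motion H p' q' \<mu>"
    and "\<And>\<mu>. inf_motion G p q \<mu> \<Longrightarrow> (\<And>w. w \<in> vertices G \<Longrightarrow> w \<noteq> v \<Longrightarrow> \<mu> w = 0) \<Longrightarrow> \<mu> v = 0"
  shows "inf_rigid G p q"
  unfolding inf_rigid_def
proof (intro allI impI ballI)
  fix \<mu> w assume \<mu>: "inf_motion G p q \<mu>" and w: "w \<in> vertices G"
  have "\<mu> w = 0" if "w \<in> vertices G" "w \<noteq> v" for w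
    using assms(1,2) assms(3)[OF \<mu>] that by (auto simp: inf_rigid_def)
  then show "\<mu> w = 0"
    using assms(4)[OF \<mu>] w by (cases "w = v") auto
qed

text \<open>Removing \<open>v\<close> costs one vertex and three rows, so one new row restores the
  balance of rows and columns.\<close>

lemma tight_graph_insert_edge:
  assumes "tight_graph G" "v \<in> vertices G" "card (neighbours G v) + card (loops_at G v) = 3"
    and "sparse_graph (delete_vertices G {v}\<lparr>edges := insert e (edges (delete_vertices G {v}))\<rparr>)"
    and "e \<notin> edges (delete_vertices G {v})"
  shows "tight_graph (delete_vertices G {v}\<lparr>edges := insert e (edges (delete_vertices G {v}))\<rparr>)"
proof -
  have G: "looped_simple_graph G" "card (edges G) + card (loops G) = 2 * card (vertices G)"
    using assms(1) by (auto simp: tight_graph_def sparse_graph_def)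
  have "card (insert e (edges (delete_vertices G {v}))) = card (edges (delete_vertices G {v})) + 1"
    using assms(5) looped_simple_graphD(2)[OF G(1)] by simp
  then show ?thesis
    using card_delete_vertex[OF G(1) assms(2)] G(2) assms(3,4) unfolding tight_graph_def
    by (simp del: delete_vertices_sel)
qed

lemma tight_graph_insert_loop:
  assumes "tight_graph G" "v \<in> vertices G" "card (neighbours G v) + card (loops_at G v) = 3"
    and "sparse_graph (delete_vertices G {v}\<lparr>loops := insert l (loops (delete_vertices G {v})),
      loop_vertex := (loop_vertex (delete_vertices G {v}))(l := u)\<rparr>)"
    and "l \<notin> loops (delete_vertices G {v})"
  shows "tight_graph (delete_vertices G {v}\<lparr>loops := insert l (loops (delete_vertices G {v})),
      loop_vertex := (loop_vertex (delete_vertices G {v}))(l := u)\<rparr>)"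
proof -
  have G: "looped_simple_graph G" "card (edges G) + card (loops G) = 2 * card (vertices G)"
    using assms(1) by (auto simp: tight_graph_def sparse_graph_def)
  have "card (insert l (loops (delete_vertices G {v}))) = card (loops (delete_vertices G {v})) + 1"
    using assms(5) looped_simple_graphD(3)[OF G(1)] by simp
  then show ?thesis
    using card_delete_vertex[OF G(1) assms(2)] G(2) assms(3,4) unfolding tight_graph_def
    by (simp del: delete_vertices_sel)
qed

lemma inf_motion_insert_edge:
  assumes "inf_motion H p q \<mu>" "inner (p u - p w) (\<mu> u - \<mu> w) = 0"
  shows "inf_motion (H\<lparr>edges := insert {u, w} (edges H)\<rparr>) p q \<mu>"
proof -
  have "inner (p w - p u) (\<mu> w - \<mu> u) = 0"
    using assms(2) by (simp add: inner_diff_left inner_diff_right)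
  then show ?thesis
    using assms by (auto simp: inf_motion_def doubleton_eq_iff)
qed

lemma inf_motion_insert_loop:
  assumes "inf_motion H p q \<mu>" "inner (q l) (\<mu> u) = 0"
  shows "inf_motion (H\<lparr>loops := insert l (loops H), loop_vertex := (loop_vertex H)(l := u)\<rparr>) p q \<mu>"
  using assms by (auto simp: inf_motion_def)

section \<open>Henneberg extension steps\<close>

text \<open>The graph without \<open>v\<close> is already tight, and two independent rows at
  \<open>v\<close> suffice to fix it.\<close>

lemma inf_rigid_add_degree_2:
  assumes "tight_graph G" "v \<in> vertices G" "card (neighbours G v) + card (loops_at G v) = 2"
    and IH: "tight_graph (delete_vertices G {v}) \<Longrightarrow> \<exists>p q. inf_rigid (delete_vertices G {v}) p q"
  shows "\<exists>p q. inf_rigid G p q"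
proof -
  let ?H = "delete_vertices G {v}"
  have sparse: "sparse_graph G" and tight: "card (edges G) + card (loops G) = 2 * card (vertices G)"
    using assms(1) by (auto simp: tight_graph_def)
  note simple = sparse_graphD(1)[OF sparse]
  have H: "tight_graph ?H"
    using sparse_delete_vertices[OF sparse] card_delete_vertex[OF simple assms(2)] tight assms(3)
    unfolding tight_graph_def by (simp del: delete_vertices_sel)
  then obtain p q where pq: "inf_rigid ?H p q"
    using IH by blast
  have extend: "\<exists>p q. inf_rigid G p q"
    if rigid: "inf_rigid ?H p q"
      and span: "\<And>y. (\<And>w. w \<in> neighbours G v \<Longrightarrow> inner (pv - p w) y = 0) \<Longrightarrow>
        (\<And>l. l \<in> loops_at G v \<Longrightarrow> inner (qv l) y = 0) \<Longrightarrow> y = 0"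
    for p q pv qv
  proof -
    let ?p = "p(v := pv)" and ?q = "\<lambda>l. if l \<in> loops_at G v then qv l else q l"
    have "inf_rigid G ?p ?q"
    proof (rule inf_rigid_extend[OF rigid])
      fix \<mu> assume \<mu>: "inf_motion G ?p ?q \<mu>"
      show "inf_motion ?H p q \<mu>"
        by (rule inf_motion_delete_vertex[OF \<mu>]) (auto simp: loops_at_def)
      assume zero: "\<And>w. w \<in> vertices G \<Longrightarrow> w \<noteq> v \<Longrightarrow> \<mu> w = 0"
      show "\<mu> v = 0"
      proof (rule span)
        fix w assume w: "w \<in> neighbours G v"
        show "inner (pv - p w) (\<mu> v) = 0"
          using inf_motion_edge[OF \<mu> w] neighboursD[OF simple w] zero[of w] by simp
      next
        fix l assume l: "l \<in> loops_at G v"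
        show "inner (qv l) (\<mu> v) = 0"
          using inf_motion_loop[OF \<mu> l] l by simp
      qed
    qed simp
    then show ?thesis
      by blast
  qed
  consider "card (neighbours G v) = 2" | "card (neighbours G v) = 1" "card (loops_at G v) = 1"
    | "card (loops_at G v) = 2"
    using assms(3) by linarith
  then show ?thesis
  proof cases
    case 1
    then obtain u w where uw: "neighbours G v = {u, w}" "u \<noteq> w"
      by (auto simp: card_2_iff)
    obtain p' where p': "inf_rigid ?H p' q" "p' u \<noteq> p' w"
      using inf_rigid_generic_pair[OF H pq uw(2)] .
    \<comment> \<open>Placing \<open>v\<close> at \<open>p' u + rot ?d\<close> keeps it off the line
      through its two neighbours.\<close>
    let ?d = "p' u - p' w"
    have "cross2 (p' u + rot ?d - p' u) (p' u + rot ?d - p' w) = cross2 (rot ?d) (?d + rot ?d)"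
      by (simp add: algebra_simps)
    also have "\<dots> = - inner ?d ?d"
      using cross2_rot[of ?d] cross2_commute[of "rot ?d" ?d] by (simp add: cross2_simps(1,2))
    finally have indep: "cross2 (p' u + rot ?d - p' u) (p' u + rot ?d - p' w) \<noteq> 0"
      using p'(2) by simp
    show ?thesis
      by (rule extend[OF p'(1), of "p' u + rot ?d" q], rule cross2_orthogonal_eq_0[OF indep])
        (simp_all only: uw insert_iff simp_thms)
  next
    case 2
    then obtain u l where ul: "neighbours G v = {u}" "loops_at G v = {l}"
      by (auto simp: card_1_singleton_iff)
    \<comment> \<open>The edge points along the first axis and the loop along the second.\<close>
    have indep: "cross2 (p u + axis 1 1 - p u) (axis 2 1) \<noteq> 0"
      by (simp add: cross2_def axis_def)
    show ?thesis
    proof (rule extend[OF pq])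
      fix y
      assume "\<And>w. w \<in> neighbours G v \<Longrightarrow> inner (p u + axis 1 1 - p w) y = 0"
        and "\<And>k. k \<in> loops_at G v \<Longrightarrow> inner (axis 2 1) y = 0"
      from this(1)[of u] this(2)[of l] show "y = 0"
        unfolding ul using cross2_orthogonal_eq_0[OF indep] by blast
    qed
  next
    case 3
    then obtain k l where kl: "loops_at G v = {k, l}" "k \<noteq> l"
      by (auto simp: card_2_iff)
    \<comment> \<open>The loops take the axis directions; \<open>v\<close> has no neighbours here,
      and 0 serves as its position.\<close>
    let ?q = "\<lambda>i. if i = k then axis 1 1 else axis 2 1 :: real^2"
    have indep: "cross2 (?q k) (?q l) \<noteq> 0"
      using kl(2) by (simp add: cross2_def axis_def)
    show ?thesis
    proof (rule extend[OF pq])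
      fix y
      assume "\<And>w. w \<in> neighbours G v \<Longrightarrow> inner (0 - p w) y = 0"
        and "\<And>i. i \<in> loops_at G v \<Longrightarrow> inner (?q i) y = 0"
      from this(2)[of k] this(2)[of l] show "y = 0"
        unfolding kl(1) by (intro cross2_orthogonal_eq_0[OF indep]) blast+
    qed
  qed
qed

text \<open>The two loops fix \<open>v\<close>, after which its edge acts on \<open>u\<close> like a
  loop. The smaller graph therefore has such a loop at \<open>u\<close>, under the label
  \<open>k\<close>.\<close>

lemma inf_rigid_add_degree_1_2:
  assumes "tight_graph G" "v \<in> vertices G"
    "card (neighbours G v) = 1" "card (loops_at G v) = 2"
    and IH: "\<And>H :: ('v, 'l) looped_graph. tight_graph H \<Longrightarrow> vertices H = vertices G - {v} \<Longrightarrow>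
      \<exists>p q. inf_rigid H p q"
  shows "\<exists>p q. inf_rigid (G :: ('v, 'l) looped_graph) p q"
proof -
  let ?D = "delete_vertices G {v}"
  have sparse: "sparse_graph G"
    using assms(1) by (auto simp: tight_graph_def)
  note simple = sparse_graphD(1)[OF sparse]
  obtain u k l where N: "neighbours G v = {u}" "loops_at G v = {k, l}" "k \<noteq> l"
    using assms(3,4) by (auto simp: card_1_singleton_iff card_2_iff)
  have u: "u \<in> vertices G" "u \<noteq> v" "u \<in> neighbours G v"
    using neighboursD[OF simple, of u v] N by auto
  have kl: "k \<in> loops_at G v" "l \<in> loops_at G v" "k \<notin> loops ?D"
    using N by (auto simp: loops_at_def)
  let ?H = "?D\<lparr>loops := insert k (loops ?D), loop_vertex := (loop_vertex ?D)(k := u)\<rparr>"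
  \<comment> \<open>A blocking set would have to accommodate \<open>v\<close> with one edge and two
    loops, more than the 2 units allowed.\<close>
  have no_tight: "\<nexists>X. u \<in> X \<and> loop_tight ?D X"
  proof
    assume "\<exists>X. u \<in> X \<and> loop_tight ?D X"
    then obtain X where X: "u \<in> X" "loop_tight G X" "v \<notin> X"
      by (auto simp: tight_delete_vertices)
    then show False
      using loop_tight_neighbours_le[OF sparse X(2) assms(2) X(3), of "{u}"] u assms(4) by simp
  qed
  have "u \<in> vertices ?D"
    using u by simp
  then have "sparse_graph ?H"
    using insert_loop_sparse_or_tight[OF sparse_delete_vertices[OF sparse] _ kl(3), of u] no_tight
    by blast
  then have "tight_graph ?H"
    using assms(3,4) by (intro tight_graph_insert_loop[OF assms(1,2)] kl) auto
  then obtain p q where pq: "inf_rigid ?H p q"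
    using IH[of ?H] by auto
  \<comment> \<open>The edge inherits the direction \<open>q k\<close> of the loop at
    \<open>u\<close>, while the loops at \<open>v\<close> receive fresh independent
    directions.\<close>
  let ?p = "p(v := p u + q k)"
  let ?q = "q(k := axis 1 1, l := axis 2 1)"
  have "inf_rigid G ?p ?q"
  proof (rule inf_rigid_extend[OF pq])
    fix \<mu> assume \<mu>: "inf_motion G ?p ?q \<mu>"
    have "cross2 (?q k) (?q l) \<noteq> 0"
      using N(3) by (simp add: cross2_def axis_def)
    then show v0: "\<mu> v = 0"
      using inf_motion_loop[OF \<mu> kl(1)] inf_motion_loop[OF \<mu> kl(2)] by (rule cross2_orthogonal_eq_0)
    show "inf_motion ?H p q \<mu>"
    proof (rule inf_motion_insert_loop)
      show "inf_motion ?D p q \<mu>"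
        using kl by (intro inf_motion_delete_vertex[OF \<mu>]) (auto simp: loops_at_def)
      show "inner (q k) (\<mu> u) = 0"
        using inf_motion_edge[OF \<mu> u(3)] u(2) v0 by simp
    qed
  qed simp
  then show ?thesis
    by blast
qed

text \<open>The loop moves to a neighbour \<open>u\<close>. Conversely \<open>v\<close> is placed so
  that its edge to \<open>u\<close> is parallel to its loop direction; together these two rows imply
  the moved loop constraint, and the edge to \<open>w\<close> fixes \<open>v\<close>.\<close>

lemma inf_rigid_add_degree_2_1:
  assumes "tight_graph G" "v \<in> vertices G"
    "card (neighbours G v) = 2" "card (loops_at G v) = 1"
    and IH: "\<And>H :: ('v, 'l) looped_graph. tight_graph H \<Longrightarrow> vertices H = vertices G - {v} \<Longrightarrow>
      \<exists>p q. inf_rigid H p q"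
  shows "\<exists>p q. inf_rigid (G :: ('v, 'l) looped_graph) p q"
proof -
  let ?D = "delete_vertices G {v}"
  have sparse: "sparse_graph G"
    using assms(1) by (auto simp: tight_graph_def)
  note simple = sparse_graphD(1)[OF sparse]
  note sparse_D = sparse_delete_vertices[OF sparse, of "{v}"]
  obtain l where l: "loops_at G v = {l}"
    using assms(4) by (auto simp: card_1_singleton_iff)
  have l': "l \<in> loops_at G v" "l \<notin> loops ?D"
    using l by (auto simp: loops_at_def)
  \<comment> \<open>If both neighbours were blocked, the union of the blocking sets would be tight
    and would receive two edges and a loop from \<open>v\<close>.\<close>
  have "\<exists>u w. neighbours G v = {u, w} \<and> u \<noteq> w \<and> (\<nexists>X. u \<in> X \<and> loop_tight ?D X)"
  proof (rule ccontr)
    assume *: "\<not> ?thesis"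
    obtain u w where N: "neighbours G v = {u, w}" "u \<noteq> w"
      using assms(3) by (auto simp: card_2_iff)
    have swap: "neighbours G v = {w, u}" "w \<noteq> u"
      using N by auto
    obtain X where "u \<in> X" "loop_tight ?D X"
      using * N by blast
    moreover obtain Y where "w \<in> Y" "loop_tight ?D Y"
      using * swap by blast
    ultimately have X: "{u, w} \<subseteq> X \<union> Y" "loop_tight ?D (X \<union> Y)"
      using loop_tight_Un[OF sparse_D] by auto
    then have "loop_tight G (X \<union> Y)" "v \<notin> X \<union> Y"
      by (auto simp: tight_delete_vertices)
    then show False
      using loop_tight_neighbours_le[OF sparse _ assms(2), of "X \<union> Y" "{u, w}"] X(1) N assms(4) by simp
  qed
  then obtain u w where N: "neighbours G v = {u, w}" "u \<noteq> w" "\<nexists>X. u \<in> X \<and> loop_tight ?D X"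
    by blast
  have u: "u \<in> vertices G" "u \<noteq> v" "u \<in> neighbours G v"
    and w: "w \<in> vertices G" "w \<noteq> v" "w \<in> neighbours G v"
    using neighboursD[OF simple, of _ v] N by auto
  let ?H = "?D\<lparr>loops := insert l (loops ?D), loop_vertex := (loop_vertex ?D)(l := u)\<rparr>"
  have "u \<in> vertices ?D"
    using u by simp
  then have "sparse_graph ?H"
    using insert_loop_sparse_or_tight[OF sparse_D _ l'(2), of u] N(3) by blast
  then have H: "tight_graph ?H"
    using assms(3,4) by (intro tight_graph_insert_loop[OF assms(1,2)] l') auto
  then obtain p0 q0 where "inf_rigid ?H p0 q0"
    using IH[of ?H] by auto
  then obtain p q where pq: "inf_rigid ?H p q" and generic: "cross2 (q l) (p u - p w) \<noteq> 0"
    using inf_rigid_generic_loop[OF H _ N(2)] by blast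
  let ?p = "p(v := p u + q l)"
  have "inf_rigid G ?p q"
  proof (rule inf_rigid_extend[OF pq])
    fix \<mu> assume \<mu>: "inf_motion G ?p q \<mu>"
    have lv: "inner (q l) (\<mu> v) = 0"
      by (rule inf_motion_loop[OF \<mu> l'(1)])
    show "inf_motion ?H p q \<mu>"
    proof (rule inf_motion_insert_loop)
      show "inf_motion ?D p q \<mu>"
        by (intro inf_motion_delete_vertex[OF \<mu>]) auto
      show "inner (q l) (\<mu> u) = 0"
        using inf_motion_edge[OF \<mu> u(3)] u(2) lv by (simp add: inner_diff_right)
    qed
    assume "\<And>w. w \<in> vertices G \<Longrightarrow> w \<noteq> v \<Longrightarrow> \<mu> w = 0"
    then have "inner (p u + q l - p w) (\<mu> v) = 0"
      using inf_motion_edge[OF \<mu> w(3)] w by simp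
    moreover have "cross2 (q l) (p u + q l - p w) \<noteq> 0"
      using generic by (simp add: cross2_simps)
    ultimately show "\<mu> v = 0"
      using lv cross2_orthogonal_eq_0 by blast
  qed simp
  then show ?thesis
    by blast
qed

text \<open>An edge between two neighbours replaces \<open>v\<close>. Putting \<open>v\<close> at
  the midpoint of that edge makes its two halves imply the constraint of the whole; the third
  neighbour, off this line, fixes \<open>v\<close>.\<close>

lemma inf_rigid_add_degree_3_0:
  assumes "tight_graph G" "v \<in> vertices G"
    "card (neighbours G v) = 3" "card (loops_at G v) = 0"
    and IH: "\<And>H :: ('v, 'l) looped_graph. tight_graph H \<Longrightarrow> vertices H = vertices G - {v} \<Longrightarrow>
      \<exists>p q. inf_rigid H p q"
  shows "\<exists>p q. inf_rigid (G :: ('v, 'l) looped_graph) p q"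
proof -
  let ?D = "delete_vertices G {v}"
  let ?H = "\<lambda>a b. ?D\<lparr>edges := insert {a, b} (edges ?D)\<rparr>"
  have sparse: "sparse_graph G"
    using assms(1) by (auto simp: tight_graph_def)
  note simple = sparse_graphD(1)[OF sparse]
  note sparse_D = sparse_delete_vertices[OF sparse, of "{v}"]
  obtain a b c where abc: "neighbours G v = {a, b, c}" "a \<noteq> b" "a \<noteq> c" "b \<noteq> c"
    using assms(3) by (auto simp: card_3_iff)
  have blocked: "\<exists>X. (edge_tight G X \<or> loop_tight G X) \<and> v \<notin> X \<and> {r, s} \<subseteq> X"
    if "r \<in> neighbours G v" "s \<in> neighbours G v" "r \<noteq> s"
      "\<not> ({r, s} \<notin> edges ?D \<and> sparse_graph (?H r s))" for r s
  proof -
    have "{r, s} \<subseteq> vertices ?D" "card {r, s} = 2"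
      using that(3) neighboursD[OF simple that(1)] neighboursD[OF simple that(2)] by auto
    then show ?thesis
      using insert_edge_sparse_or_tight[OF sparse_D, of "{r, s}"] that(4)
      by (auto simp: tight_delete_vertices)
  qed
  have "\<exists>u w x. neighbours G v = {u, w, x} \<and> u \<noteq> w \<and> u \<noteq> x \<and> w \<noteq> x \<and>
      {u, w} \<notin> edges ?D \<and> sparse_graph (?H u w)"
  proof (rule ccontr)
    assume *: "\<not> ?thesis"
    \<comment> \<open>The first two entries of a triple form the new edge, so the other two pairs
      need reordered listings of the neighbours.\<close>
    have perms: "neighbours G v = {a, c, b}" "neighbours G v = {b, c, a}"
      using abc(1) by auto
    have 1: "\<not> ({a, b} \<notin> edges ?D \<and> sparse_graph (?H a b))"
      using * abc by blast
    have 2: "\<not> ({a, c} \<notin> edges ?D \<and> sparse_graph (?H a c))"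
      using * perms(1) abc(2-4) by blast
    have 3: "\<not> ({b, c} \<notin> edges ?D \<and> sparse_graph (?H b c))"
      using * perms(2) abc(2-4) by blast
    obtain A where A: "edge_tight G A \<or> loop_tight G A" "v \<notin> A" "{a, b} \<subseteq> A"
      using blocked[OF _ _ abc(2) 1] abc(1) by auto
    obtain B where B: "edge_tight G B \<or> loop_tight G B" "v \<notin> B" "{a, c} \<subseteq> B"
      using blocked[OF _ _ abc(3) 2] abc(1) by auto
    obtain C where C: "edge_tight G C \<or> loop_tight G C" "v \<notin> C" "{b, c} \<subseteq> C"
      using blocked[OF _ _ abc(4) 3] abc(1) by auto
    show False
      using no_three_tight_sets[OF sparse assms(2) _ abc(2-4) A B C] abc(1) by simp
  qed
  then obtain u w x where N: "neighbours G v = {u, w, x}" "u \<noteq> w" "u \<noteq> x" "w \<noteq> x"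
    and H': "{u, w} \<notin> edges ?D" "sparse_graph (?H u w)"
    by blast
  have u: "u \<in> vertices G" "u \<noteq> v" "u \<in> neighbours G v"
    and w: "w \<in> vertices G" "w \<noteq> v" "w \<in> neighbours G v"
    and x: "x \<in> vertices G" "x \<noteq> v" "x \<in> neighbours G v"
    using neighboursD[OF simple, of _ v] N by auto
  have H: "tight_graph (?H u w)"
    using assms(3,4) H' by (intro tight_graph_insert_edge[OF assms(1,2)]) auto
  then obtain p0 q where "inf_rigid (?H u w) p0 q"
    using IH[of "?H u w"] by auto
  then obtain p where p: "inf_rigid (?H u w) p q"
    and generic: "cross2 (p u - p w) (p u - p x) \<noteq> 0"
    using inf_rigid_generic_triple[OF H _ N(2-4)] by blast
  \<comment> \<open>\<open>p u - ?d\<close> is the midpoint of \<open>p u\<close> and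
    \<open>p w\<close>.\<close>
  let ?d = "(1/2) *\<^sub>R (p u - p w)"
  let ?p = "p(v := p u - ?d)"
  have "inf_rigid G ?p q"
  proof (rule inf_rigid_extend[OF p])
    fix \<mu> assume \<mu>: "inf_motion G ?p q \<mu>"
    have uv: "inner (p u - p w) (\<mu> v - \<mu> u) = 0"
      using inf_motion_edge[OF \<mu> u(3)] u(2) by simp
    have "p u - ?d - p w = ?d"
      by (simp add: Finite_Cartesian_Product.vec_eq_iff field_simps)
    moreover have "inner (p u - ?d - p w) (\<mu> v - \<mu> w) = 0"
      using inf_motion_edge[OF \<mu> w(3)] w(2) by simp
    ultimately have "inner ?d (\<mu> v - \<mu> w) = 0"
      by (simp only:)
    then have wv: "inner (p u - p w) (\<mu> v - \<mu> w) = 0"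
      by simp
    show "inf_motion (?H u w) p q \<mu>"
    proof (rule inf_motion_insert_edge)
      show "inf_motion ?D p q \<mu>"
        by (intro inf_motion_delete_vertex[OF \<mu>]) auto
      show "inner (p u - p w) (\<mu> u - \<mu> w) = 0"
        using uv wv by (simp add: inner_diff_right)
    qed
    assume zero: "\<And>w. w \<in> vertices G \<Longrightarrow> w \<noteq> v \<Longrightarrow> \<mu> w = 0"
    have "inner (p u - p w) (\<mu> v) = 0"
      using uv zero[OF u(1,2)] by simp
    moreover have "inner (p u - ?d - p x) (\<mu> v) = 0"
      using inf_motion_edge[OF \<mu> x(3)] x(2) zero[OF x(1,2)] by simp
    \<comment> \<open>Moving along the line through \<open>u\<close> and \<open>w\<close> does not
      affect the cross product with its direction.\<close>
    moreover have "cross2 (p u - p w) (p u - ?d - p x) = cross2 (p u - p w) (p u - p x)"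
    proof -
      have "p u - ?d - p x = (p u - p x) - ?d"
        by simp
      then show ?thesis
        by (simp only: cross2_simps(1) cross2_simps(4)[of _ "p u - p x"] cross2_simps(7))
    qed
    ultimately show "\<mu> v = 0"
      using generic cross2_orthogonal_eq_0 by metis
  qed simp
  then show ?thesis
    by blast
qed

section \<open>Henneberg induction and conclusion\<close>

lemma tight_graph_imp_inf_rigid:
  assumes "tight_graph G"
  shows "\<exists>p q. inf_rigid G p q"
  using assms
proof (induction "card (vertices G)" arbitrary: G rule: less_induct)
  case less
  show ?case
  proof (cases "vertices G = {}")
    case False
    obtain v where v: "v \<in> vertices G" "2 \<le> card (neighbours G v) + card (loops_at G v)"
      "card (neighbours G v) + card (loops_at G v) \<le> 3" "card (loops_at G v) \<le> 2"
      using tight_graph_small_degree[OF less.prems False] .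
    have fin: "finite (vertices G)"
      using less.prems by (simp add: tight_graph_def sparse_graph_def looped_simple_graph_def)
    have IH: "\<exists>p q. inf_rigid H p q"
      if "tight_graph H" "vertices H = vertices G - {v}" for H :: "('a, 'b) looped_graph"
    proof -
      have "card (vertices H) < card (vertices G)"
        using that(2) card_Diff1_less[OF fin v(1)] by simp
      then show ?thesis
        using less.hyps that(1) by blast
    qed
    \<comment> \<open>Three loops at \<open>v\<close> are excluded, which leaves three kinds of
      degree-three vertices.\<close>
    consider "card (neighbours G v) + card (loops_at G v) = 2"
      | "card (neighbours G v) = 1" "card (loops_at G v) = 2"
      | "card (neighbours G v) = 2" "card (loops_at G v) = 1"
      | "card (neighbours G v) = 3" "card (loops_at G v) = 0"
      using v(2-4) by linarith
    then show ?thesis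
    proof cases
      case 1
      then show ?thesis
        using IH by (intro inf_rigid_add_degree_2[OF less.prems v(1)]) auto
    next
      case 2
      then show ?thesis
        by (rule inf_rigid_add_degree_1_2[OF less.prems v(1)]) (rule IH)
    next
      case 3
      then show ?thesis
        by (rule inf_rigid_add_degree_2_1[OF less.prems v(1)]) (rule IH)
    next
      case 4
      then show ?thesis
        by (rule inf_rigid_add_degree_3_0[OF less.prems v(1)]) (rule IH)
    qed
  next
    case True
    then have "inf_rigid G (\<lambda>_. 0) (\<lambda>_. 0)"
      by (simp add: inf_rigid_def)
    then show ?thesis
      by blast
  qed
qed

theorem theorem1p5:
  fixes G :: "('v, 'l) looped_graph"
  assumes "looped_simple_graph G"
    and "balanced 6 G"
  shows "rigid G"
proof -
  obtain F K where FK: "F \<subseteq> edges G" "K \<subseteq> loops G" "sparse_graph (G\<lparr>edges := F, loops := K\<rparr>)"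
    "card F + card K = 2 * card (vertices G)"
    using balanced_imp_tight_subgraph[OF assms] .
  then have "tight_graph (G\<lparr>edges := F, loops := K\<rparr>)"
    by (simp add: tight_graph_def)
  then obtain p q where "inf_rigid (G\<lparr>edges := F, loops := K\<rparr>) p q"
    using tight_graph_imp_inf_rigid by blast
  \<comment> \<open>Further edges and loops only add constraints, so rigidity passes from the
    spanning subgraph to \<open>G\<close>.\<close>
  moreover have "inf_motion (G\<lparr>edges := F, loops := K\<rparr>) p q \<mu>" if "inf_motion G p q \<mu>" for \<mu>
    using that FK(1,2) by (auto simp: inf_motion_def)
  ultimately have "inf_rigid G p q"
    by (simp add: inf_rigid_def)
  then show ?thesis
    by (rule inf_rigid_imp_rigid[OF assms(1)])
qed

end
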